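(* Let $K \subset \mathbb{R}^{2}$ be a compact sub-uniformly distributed set with $\dim_{\mathrm{H}} K = t \in (0,2)$. For every $\max\{t-1,0\} < s \leq 1$ and $\mathcal{H}^{1}$ almost every $e \in S^{1}$, $$\dim_{\mathrm{H}} \underline{H}(K,e,s) \leq \max\{t-s,0\}.$$ Additionally, if $K$ is $t$-Ahlfors regular, then for every $\max\{t-1,0\} < s \leq 1$ and $\mathcal{H}^{1}$ almost every $e \in S^{1}$, $\dim_{\mathrm{H}} \overline{H}(K,e,s) \leq \max\{t-s,0\}$.
   Context: $\dim_{\mathrm{H}}$, $\underline{\dim}_{\mathrm{B}}$, $\overline{\dim}_{\mathrm{B}}$ are Hausdorff, lower box-counting and upper box-counting dimension, with the convention $\dim_{\mathrm{H}} \emptyset = 0$. $\mathcal{H}^{1}$ on $S^{1}$ is arc-length. For $e \in S^{1}$ and $z \in \mathbb{R}^{2}$ write $\ell_{e,z} := z + \mathrm{span}(e)$. Define $$\underline{H}(K,e,s) := \{z \in K : \underline{\dim}_{\mathrm{B}}(K \cap \ell_{e,z}) \geq s\}, \qquad \overline{H}(K,e,s) := \{z \in K : \overline{\dim}_{\mathrm{B}}(K \cap \ell_{e,z}) \geq s\}.$$ For a dyadic number $r \in 2^{\mathbb{Z}}$, let $\mathcal{D}_{r}(\mathbb{R}^{d})$ be the standard (half-open) dyadic cubes of side-length $r$; for $P \subset \mathbb{R}^{d}$ let $\mathcal{D}_{r}(P) := \{Q \in \mathcal{D}_{r}(\mathbb{R}^{d}) : Q \cap P \neq \emptyset\}$ and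 $|P|_{r} := |\mathcal{D}_{r}(P)|$. A bounded set $K \subset \mathbb{R}^{d}$ is sub-uniformly distributed if there exists a constant $C > 0$ such that $$|K|_{R} \cdot |K \cap Q|_{r} \leq C|K|_{r}, \qquad Q \in \mathcal{D}_{R}(K), \quad 0 < r \leq R < \infty.$$ A compact set $K$ is $t$-Ahlfors regular if there is $C \geq 1$ such that $C^{-1}r^{t} \leq \mathcal{H}^{t}(K \cap B(x,r)) \leq Cr^{t}$ for all $x \in K$ and $0 < r \leq \operatorname{diam}(K)$. *)

theory Defs
  imports "HOL-Analysis.Analysis"
begin

section \<open>Hausdorff measure and dimension\<close>

text \<open>
  The empty set contributes 0, and for exponent 0 every nonempty set contributes 1
  (note that \<open>0 powr 0 = 0\<close> in the library).
\<close>

definition diam_power :: "real \<Rightarrow> 'a::metric_space set \<Rightarrow> ennreal" where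
  "diam_power s U =
    (if U = {} then 0 else if s = 0 then 1 else ennreal (diameter U powr s))"

text \<open>
  Boundedness is required explicitly, here and below, because \<^const>\<open>diameter\<close> of an unbounded
  set is a meaningless real number.
\<close>

definition hausdorff_premeasure :: "real \<Rightarrow> real \<Rightarrow> 'a::metric_space set \<Rightarrow> ennreal" where
  "hausdorff_premeasure s \<delta> E =
    (INF U \<in> {U :: nat \<Rightarrow> 'a set. E \<subseteq> (\<Union>i. U i) \<and> (\<forall>i. bounded (U i) \<and> diameter (U i) \<le> \<delta>)}.
      (\<Sum>i. diam_power s (U i)))"

text \<open>
  The outer measure, defined on all sets; the premeasure increases as \<open>\<delta>\<close> decreases, so the
  supremum is the limit as \<open>\<delta>\<close> tends to 0. With this normalisation the one-dimensional measure
  of an arc is its length.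
\<close>

definition hausdorff_measure :: "real \<Rightarrow> 'a::metric_space set \<Rightarrow> ennreal" where
  "hausdorff_measure s E = (SUP \<delta> \<in> {0<..}. hausdorff_premeasure s \<delta> E)"

definition hausdorff_dim :: "'a::metric_space set \<Rightarrow> ereal" where
  "hausdorff_dim E = (INF s \<in> {s. 0 \<le> s \<and> hausdorff_measure s E = 0}. ereal s)"

lemma hausdorff_dim_empty: "hausdorff_dim ({} :: 'a::metric_space set) = 0"
proof (rule antisym)
  have "hausdorff_premeasure 0 \<delta> ({} :: 'a set) = 0" if "\<delta> > 0" for \<delta>
  proof -
    have "hausdorff_premeasure 0 \<delta> ({} :: 'a set) \<le> (\<Sum>i::nat. diam_power 0 ({} :: 'a set))"
      unfolding hausdorff_premeasure_def
      by (rule INF_lower2[where i = "\<lambda>_. {}"]) (use that in auto)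
    then show ?thesis by (simp add: diam_power_def)
  qed
  then have "hausdorff_measure 0 ({} :: 'a set) = 0"
    by (simp add: hausdorff_measure_def)
  then show "hausdorff_dim ({} :: 'a set) \<le> 0"
    unfolding hausdorff_dim_def by (intro INF_lower2[where i = 0]) auto
  show "0 \<le> hausdorff_dim ({} :: 'a set)"
    unfolding hausdorff_dim_def by (intro INF_greatest) auto
qed

section \<open>Box-counting dimensions\<close>

text \<open>
  The least number of sets of diameter at most \<open>\<delta>\<close> needed to cover \<open>E\<close>. This and the two
  dimensions below are meaningful for nonempty totally bounded \<open>E\<close> only.
\<close>

definition covering_number :: "'a::metric_space set \<Rightarrow> real \<Rightarrow> nat" where
  "covering_number E \<delta> =
    Inf {card \<U> | \<U>. finite \<U> \<and> E \<subseteq> \<Union>\<U> \<and> (\<forall>U\<in>\<U>. bounded U \<and> diameter U \<le> \<delta>)}"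

definition lower_box_dim :: "'a::metric_space set \<Rightarrow> ereal" where
  "lower_box_dim E =
    Liminf (at_right 0) (\<lambda>\<delta>. ereal (ln (real (covering_number E \<delta>)) / ln (1 / \<delta>)))"

definition upper_box_dim :: "'a::metric_space set \<Rightarrow> ereal" where
  "upper_box_dim E =
    Limsup (at_right 0) (\<lambda>\<delta>. ereal (ln (real (covering_number E \<delta>)) / ln (1 / \<delta>)))"

section \<open>Dyadic cubes and sub-uniformly distributed sets\<close>

definition dyadic_numbers :: "real set" where
  "dyadic_numbers = range (\<lambda>k::int. 2 powi k)"

definition dyadic_cubes :: "real \<Rightarrow> 'a::euclidean_space set set" where
  "dyadic_cubes r =
    range (\<lambda>k :: 'a \<Rightarrow> int.
      {x. \<forall>b\<in>Basis. r * of_int (k b) \<le> x \<bullet> b \<and> x \<bullet> b < r * (of_int (k b) + 1)})"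

definition dyadic_cubes_meeting :: "real \<Rightarrow> 'a::euclidean_space set \<Rightarrow> 'a set set" where
  "dyadic_cubes_meeting r P = {Q \<in> dyadic_cubes r. Q \<inter> P \<noteq> {}}"

text \<open>The number \<open>|P|\<^sub>r\<close>; the family counted is finite when \<open>P\<close> is bounded and \<open>r > 0\<close>.\<close>

definition dyadic_count :: "real \<Rightarrow> 'a::euclidean_space set \<Rightarrow> nat" where
  "dyadic_count r P = card (dyadic_cubes_meeting r P)"

definition sub_uniformly_distributed :: "'a::euclidean_space set \<Rightarrow> bool" where
  "sub_uniformly_distributed K \<longleftrightarrow>
    bounded K \<and>
    (\<exists>C::real. C > 0 \<and>
      (\<forall>r\<in>dyadic_numbers. \<forall>R\<in>dyadic_numbers. r \<le> R \<longrightarrow>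
        (\<forall>Q\<in>dyadic_cubes_meeting R K.
          real (dyadic_count R K) * real (dyadic_count r (K \<inter> Q)) \<le> C * real (dyadic_count r K))))"

section \<open>Ahlfors regular sets\<close>

definition ahlfors_regular :: "real \<Rightarrow> 'a::metric_space set \<Rightarrow> bool" where
  "ahlfors_regular t K \<longleftrightarrow>
    compact K \<and>
    (\<exists>C::real. C \<ge> 1 \<and>
      (\<forall>x\<in>K. \<forall>r. 0 < r \<and> r \<le> diameter K \<longrightarrow>
        ennreal (r powr t / C) \<le> hausdorff_measure t (K \<inter> cball x r) \<and>
        hausdorff_measure t (K \<inter> cball x r) \<le> ennreal (C * r powr t)))"

section \<open>Points on large line slices\<close>

definition line_through :: "'a::real_vector \<Rightarrow> 'a \<Rightarrow> 'a set" where
  "line_through e z = (\<lambda>v. z + v) ` span {e}"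

definition lower_H :: "'a::real_normed_vector set \<Rightarrow> 'a \<Rightarrow> real \<Rightarrow> 'a set" where
  "lower_H K e s = {z \<in> K. lower_box_dim (K \<inter> line_through e z) \<ge> ereal s}"

definition upper_H :: "'a::real_normed_vector set \<Rightarrow> 'a \<Rightarrow> real \<Rightarrow> 'a set" where
  "upper_H K e s = {z \<in> K. upper_box_dim (K \<inter> line_through e z) \<ge> ereal s}"

section \<open>Almost every direction\<close>

text \<open>
  Almost everywhere on the unit sphere with respect to one-dimensional Hausdorff measure. Since
  \<open>hausdorff_measure\<close> is an outer measure, no measurability of the exceptional set is asked for.
\<close>

definition almost_every_direction :: "(real^2 \<Rightarrow> bool) \<Rightarrow> bool" where
  "almost_every_direction P \<longleftrightarrow> hausdorff_measure 1 {e \<in> sphere 0 1. \<not> P e} = 0"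

end

theory Submission
  imports Defs
begin

text \<open>
  With the two coordinates \<open>i, i'\<close> in a suitable order, every line is a fibre of
  \<open>z \<mapsto> z $ i - m * z $ i'\<close> for a slope \<open>m\<close> with \<open>\<bar>m\<bar> \<le> 1\<close>. Fix a base \<open>b\<close>, a power of two,
  and let \<open>P\<^sub>j\<close> be the set of grid cells of side \<open>b\<^sup>-\<^sup>j\<close> that meet \<open>K\<close>, with \<open>N\<^sub>j\<close> elements.
  The tube of width about \<open>b\<^sup>-\<^sup>j\<close> around a line contains a cell for every piece that is
  needed to cover the slice at that scale, so the tubes through a point of \<open>lower_H\<close>
  contain at least about \<open>b\<^sup>j\<^sup>s\<close> cells of \<open>P\<^sub>j\<close> for all large \<open>j\<close>, and those through a point of \<open>upper_H\<close>
  for infinitely many \<open>j\<close>.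

  The proof compares the number of cells in a tube of width \<open>b\<^sup>-\<^sup>j\<close> with the average number
  over the surrounding tube of width \<open>b\<^sup>-\<^sup>j\<^sup>+\<^sup>1\<close>. The difference \<open>fluct\<close> is a sum over cells of a
  kernel of mean zero. Integrating its square over all tubes and all slopes leads to pairs of
  cells; for a pair with vertical distance \<open>n\<close> the integral over the slope would vanish, were it not
  for a cut-off in \<open>m\<close>, and is therefore \<open>O(n\<^sup>-\<^sup>2)\<close>. As only \<open>O(n)\<close> cells at vertical distance \<open>n\<close>
  can share a tube with a given cell, the second moment is \<open>O(N\<^sub>j \<sqdot> j)\<close>, as small as for a random
  set (\<open>tent_energy_bound\<close>).

  Call a cell bad if its tube contains at least \<open>N\<^sub>j b\<^sup>j\<^sup>(\<^sup>h\<^sup>-\<^sup>1\<^sup>)\<close> cells and at least twice as many as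
  its surroundings predict. Chebyshev's inequality and the second moment bound
  the number of bad cells by \<open>b\<^sup>j\<^sup>(\<^sup>1\<^sup>-\<^sup>h\<^sup>)\<close> up to factors \<open>b\<^sup>j\<^sup>\<epsilon>\<close>, for almost every slope
  (\<open>summable_bad\<close>). Hence the points that lie in bad cells at infinitely many scales form a set of
  dimension at most \<open>1 - h\<close> (\<open>hausdorff_null_limsup\<close>).

  It remains to see that points on rich slices are of this kind. If the cell of a point at scale \<open>j\<close> is
  not bad, then sub-uniform distribution shows that the normalised density of cells in its tube
  exceeds that at scale \<open>j - 1\<close> by a constant factor at most (\<open>good_cell_step\<close>), and this factor is
  below \<open>b\<^sup>h\<close> if \<open>b\<close> is large. A density of \<open>b\<^sup>j\<^sup>h\<^sup>'\<close> with \<open>h' > h\<close> cannot build up at this rate, so a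
  point with such densities at infinitely many scales lies in infinitely many bad cells
  (\<open>path_bad_infinitely_often\<close>). At a scale where \<open>N\<^sub>j\<close> is at most about \<open>b\<^sup>j\<^sup>t\<close>, a tube with \<open>b\<^sup>j\<^sup>s\<close>
  cells has density about \<open>b\<^sup>j\<^sup>(\<^sup>s\<^sup>-\<^sup>t\<^sup>+\<^sup>1\<^sup>)\<close>, and \<open>1 - (s - t + 1) = t - s\<close> is the exponent in the theorem.

  Such scales occur infinitely often, because a sub-uniformly distributed compact set
  with \<open>N\<^sub>j > b\<^sup>j\<^sup>u\<close> at all small scales has positive \<open>u\<close>-dimensional measure
  (\<open>few_cells_infinitely_often\<close>). This suffices for the lower box dimension, where slices are rich at all small
  scales. For the upper box dimension the rich scales are not under control, and Ahlfors regularity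
  provides the bound on \<open>N\<^sub>j\<close> at all small scales (\<open>ahlfors_regular_eventually_few_cells\<close>).
\<close>

section \<open>Hausdorff premeasures\<close>

lemma premeasure_le_suminf:
  assumes "E \<subseteq> (\<Union>i. U i)" "\<And>i::nat. bounded (U i)" "\<And>i. diameter (U i) \<le> \<delta>"
  shows "hausdorff_premeasure s \<delta> E \<le> (\<Sum>i. diam_power s (U i))"
  unfolding hausdorff_premeasure_def by (rule INF_lower) (use assms in auto)

lemma premeasure_mono: "E \<subseteq> F \<Longrightarrow> hausdorff_premeasure s \<delta> E \<le> hausdorff_premeasure s \<delta> F"
  unfolding hausdorff_premeasure_def by (rule INF_superset_mono) auto

lemma premeasure_antimono:
  "\<delta> \<le> \<delta>' \<Longrightarrow> hausdorff_premeasure s \<delta>' E \<le> hausdorff_premeasure s \<delta> E"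
  unfolding hausdorff_premeasure_def by (rule INF_superset_mono) (auto intro: order_trans)

lemma premeasure_countable_subadditive:
  fixes E :: "nat \<Rightarrow> 'a::metric_space set"
  shows "hausdorff_premeasure s \<delta> (\<Union>n. E n) \<le> (\<Sum>n. hausdorff_premeasure s \<delta> (E n))"
proof (rule ennreal_le_epsilon)
  fix e :: real assume "e > 0" and fin: "(\<Sum>n. hausdorff_premeasure s \<delta> (E n)) < top"
  define e' where "e' n = e * (1/2) ^ Suc n" for n
  have e': "e' n > 0" for n using \<open>e > 0\<close> by (simp add: e'_def)
  have "\<exists>U. E n \<subseteq> (\<Union>i::nat. U i) \<and> (\<forall>i. bounded (U i) \<and> diameter (U i) \<le> \<delta>) \<and>
     (\<Sum>i. diam_power s (U i)) < hausdorff_premeasure s \<delta> (E n) + ennreal (e' n)" for n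
  proof -
    have "hausdorff_premeasure s \<delta> (E n) \<noteq> top"
      using fin by (metis ennreal_suminf_lessD less_irrefl)
    then have "hausdorff_premeasure s \<delta> (E n) < hausdorff_premeasure s \<delta> (E n) + ennreal (e' n)"
      using e'[of n] by (cases "hausdorff_premeasure s \<delta> (E n)") (auto simp: ennreal_plus[symmetric] ennreal_less_iff simp del: ennreal_plus)
    then show ?thesis
      by (subst (asm) (1) hausdorff_premeasure_def) (auto simp: INF_less_iff)
  qed
  then obtain U where U: "\<And>n. E n \<subseteq> (\<Union>i::nat. U n i)" "\<And>n i. bounded (U n i)"
      "\<And>n i. diameter (U n i) \<le> \<delta>"
      "\<And>n. (\<Sum>i. diam_power s (U n i)) < hausdorff_premeasure s \<delta> (E n) + ennreal (e' n)"
    by metis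
  define V where "V i = (case prod_decode i of (n, k) \<Rightarrow> U n k)" for i
  have "(\<Union>n. E n) \<subseteq> (\<Union>i. V i)"
  proof
    fix x assume "x \<in> (\<Union>n. E n)"
    then obtain n k where "x \<in> U n k" using U(1) by blast
    then have "x \<in> V (prod_encode (n, k))" by (simp add: V_def)
    then show "x \<in> (\<Union>i. V i)" by blast
  qed
  then have "hausdorff_premeasure s \<delta> (\<Union>n. E n) \<le> (\<Sum>i. diam_power s (V i))"
    by (rule premeasure_le_suminf) (use U in \<open>auto simp: V_def split: prod.split\<close>)
  also have "\<dots> = (\<Sum>n. \<Sum>i. diam_power s (U n i))"
    using suminf_ennreal_2dimen[of "\<lambda>n. \<Sum>i. diam_power s (U n i)" "\<lambda>p. diam_power s (U (fst p) (snd p))"]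
    by (simp add: V_def case_prod_beta)
  also have "\<dots> \<le> (\<Sum>n. hausdorff_premeasure s \<delta> (E n) + ennreal (e' n))"
    by (intro suminf_le summableI less_imp_le U)
  also have "\<dots> = (\<Sum>n. hausdorff_premeasure s \<delta> (E n)) + (\<Sum>n. ennreal (e' n))"
    by (simp add: suminf_add)
  also have "(\<Sum>n. ennreal (e' n)) = ennreal e"
    using sums_mult[OF power_half_series, of e] e' 
    by (subst suminf_ennreal_eq[where x=e]) (auto simp: e'_def[abs_def] less_imp_le)
  finally show "hausdorff_premeasure s \<delta> (\<Union>n. E n) \<le> (\<Sum>n. hausdorff_premeasure s \<delta> (E n)) + ennreal e" .
qed

lemma premeasure_empty: "\<delta> \<ge> 0 \<Longrightarrow> hausdorff_premeasure s \<delta> {} = 0"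
  using premeasure_le_suminf[of "{}" "\<lambda>_. {}" \<delta> s] by (simp add: diam_power_def)

lemma premeasure_finite_subadditive:
  assumes "\<delta> \<ge> 0" "finite I"
  shows "hausdorff_premeasure s \<delta> (\<Union>i\<in>I. E i) \<le> (\<Sum>i\<in>I. hausdorff_premeasure s \<delta> (E i))"
proof -
  obtain n and f :: "nat \<Rightarrow> 'a" where f: "bij_betw f {..<n} I"
    using ex_bij_betw_nat_finite[OF assms(2)] by (auto simp: atLeast0LessThan)
  define G where "G i = (if i < n then E (f i) else {})" for i
  have "(\<Union>i\<in>I. E i) = (\<Union>i. G i)"
    unfolding bij_betw_imp_surj_on[OF f, symmetric] by (auto simp: G_def split: if_splits)
  then have "hausdorff_premeasure s \<delta> (\<Union>i\<in>I. E i) \<le> (\<Sum>i. hausdorff_premeasure s \<delta> (G i))"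
    using premeasure_countable_subadditive[of s \<delta> G] by simp
  also have "\<dots> = (\<Sum>i<n. hausdorff_premeasure s \<delta> (G i))"
    by (rule suminf_finite) (auto simp: G_def premeasure_empty assms)
  also have "\<dots> = (\<Sum>i<n. hausdorff_premeasure s \<delta> (E (f i)))"
    by (simp add: G_def)
  also have "\<dots> = (\<Sum>i\<in>I. hausdorff_premeasure s \<delta> (E i))"
    by (rule sum.reindex_bij_betw[OF f])
  finally show ?thesis .
qed

lemma premeasure_le_diam_power:
  assumes "bounded U" "diameter U \<le> \<delta>" "\<delta> \<ge> 0"
  shows "hausdorff_premeasure s \<delta> U \<le> diam_power s U"
proof -
  have "hausdorff_premeasure s \<delta> U \<le> (\<Sum>i::nat. diam_power s (if i = 0 then U else {}))"
    by (rule premeasure_le_suminf) (use assms in auto)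
  also have "\<dots> = (\<Sum>i\<in>{0::nat}. diam_power s (if i = 0 then U else {}))"
    by (rule suminf_finite) (auto simp: diam_power_def)
  finally show ?thesis by simp
qed

lemma hausdorff_measure_eq_0_iff:
  "hausdorff_measure s E = 0 \<longleftrightarrow> (\<forall>\<delta>>0. hausdorff_premeasure s \<delta> E = 0)"
  by (auto simp: hausdorff_measure_def bot_ennreal[symmetric] SUP_bot_conv)

lemma hausdorff_measure_mono: "E \<subseteq> F \<Longrightarrow> hausdorff_measure s E \<le> hausdorff_measure s F"
  unfolding hausdorff_measure_def by (intro SUP_mono) (use premeasure_mono in blast)

lemma hausdorff_null_Un:
  assumes "hausdorff_measure s E = 0" "hausdorff_measure s F = 0"
  shows "hausdorff_measure s (E \<union> F) = 0"
  unfolding hausdorff_measure_eq_0_iff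
proof (intro allI impI)
  fix \<delta> :: real assume "\<delta> > 0"
  have "hausdorff_premeasure s \<delta> (\<Union>b\<in>(UNIV::bool set). if b then E else F)
    \<le> (\<Sum>b\<in>(UNIV::bool set). hausdorff_premeasure s \<delta> (if b then E else F))"
    by (rule premeasure_finite_subadditive) (use \<open>\<delta> > 0\<close> in auto)
  also have "\<dots> = 0"
    using assms \<open>\<delta> > 0\<close> by (simp add: UNIV_bool hausdorff_measure_eq_0_iff)
  finally show "hausdorff_premeasure s \<delta> (E \<union> F) = 0"
    by (simp add: UNIV_bool Un_commute)
qed

lemma hausdorff_dim_le:
  "0 \<le> u \<Longrightarrow> hausdorff_measure u E = 0 \<Longrightarrow> hausdorff_dim E \<le> ereal u"
  unfolding hausdorff_dim_def by (rule INF_lower) auto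

text \<open>
  The Borel--Cantelli covering argument: for every \<open>n\<close> the sets of the levels \<open>j \<ge> n\<close> cover \<open>Z\<close>, and
  the tails of a convergent series tend to 0.
\<close>

lemma hausdorff_null_limsup:
  fixes Q :: "nat \<Rightarrow> 'i \<Rightarrow> 'a::metric_space set" and I :: "nat \<Rightarrow> 'i set"
  assumes "u > 0" "c \<ge> 0"
    and fin: "\<And>j. finite (I j)"
    and sm: "summable (\<lambda>j. real (card (I j)) * r j powr u)"
    and r: "\<And>j. r j > 0" "r \<longlonglongrightarrow> 0"
    and Q: "\<And>j i. bounded (Q j i)" "\<And>j i. diameter (Q j i) \<le> c * r j"
    and Z: "\<And>z. z \<in> Z \<Longrightarrow> \<exists>\<^sub>\<infinity>j. \<exists>i\<in>I j. z \<in> Q j i"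
  shows "hausdorff_measure u Z = 0"
  unfolding hausdorff_measure_eq_0_iff
proof (intro allI impI)
  fix \<delta> :: real assume "\<delta> > 0"
  define a where "a j = real (card (I j)) * r j powr u" for j
  have a0: "a j \<ge> 0" for j by (simp add: a_def)
  have "hausdorff_premeasure u \<delta> Z \<le> ennreal e" if "e > 0" for e
  proof -
    have "(\<lambda>n. c powr u * (\<Sum>j. a (j + n))) \<longlonglongrightarrow> c powr u * 0"
      by (intro tendsto_mult tendsto_const suminf_exist_split2) (use sm in \<open>simp add: a_def[abs_def]\<close>)
    then have "eventually (\<lambda>n. c powr u * (\<Sum>j. a (j + n)) < e) sequentially"
      using \<open>e > 0\<close> by (intro order_tendstoD) auto
    moreover have "(\<lambda>j. c * r j) \<longlonglongrightarrow> c * 0" by (intro tendsto_intros r)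
    then have "eventually (\<lambda>j. c * r j < \<delta>) sequentially"
      using \<open>\<delta> > 0\<close> by (intro order_tendstoD) auto
    ultimately have "eventually (\<lambda>n. c powr u * (\<Sum>j. a (j + n)) < e \<and> c * r n < \<delta>) sequentially"
      by (rule eventually_conj)
    then obtain n where n: "c powr u * (\<Sum>j. a (j + n)) < e" "\<And>j. j \<ge> n \<Longrightarrow> c * r j < \<delta>"
      unfolding eventually_sequentially by auto
    have "Z \<subseteq> (\<Union>j. \<Union>i\<in>I (j + n). Q (j + n) i)"
    proof
      fix z assume "z \<in> Z"
      then obtain j where "j \<ge> n" "\<exists>i\<in>I j. z \<in> Q j i" 
        using Z[OF \<open>z \<in> Z\<close>] unfolding INFM_nat_le by blast
      then show "z \<in> (\<Union>j. \<Union>i\<in>I (j + n). Q (j + n) i)"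
        by (auto intro!: exI[of _ "j - n"])
    qed
    then have "hausdorff_premeasure u \<delta> Z \<le> hausdorff_premeasure u \<delta> (\<Union>j. \<Union>i\<in>I (j + n). Q (j + n) i)"
      by (rule premeasure_mono)
    also have "\<dots> \<le> (\<Sum>j. hausdorff_premeasure u \<delta> (\<Union>i\<in>I (j + n). Q (j + n) i))"
      by (rule premeasure_countable_subadditive)
    also have "\<dots> \<le> (\<Sum>j. ennreal (c powr u * a (j + n)))"
    proof (intro suminf_le summableI)
      fix j
      have "hausdorff_premeasure u \<delta> (\<Union>i\<in>I (j + n). Q (j + n) i)
        \<le> (\<Sum>i\<in>I (j + n). hausdorff_premeasure u \<delta> (Q (j + n) i))"
        by (rule premeasure_finite_subadditive) (use \<open>\<delta> > 0\<close> fin in auto)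
      also have "\<dots> \<le> (\<Sum>i\<in>I (j + n). ennreal ((c * r (j + n)) powr u))"
      proof (rule sum_mono)
        fix i
        have d: "diameter (Q (j+n) i) \<le> \<delta>" using Q(2)[of "j+n" i] n(2)[of "j+n"] by simp
        have "hausdorff_premeasure u \<delta> (Q (j + n) i) \<le> diam_power u (Q (j + n) i)"
          by (rule premeasure_le_diam_power) (use \<open>\<delta> > 0\<close> Q d in auto)
        also have "\<dots> \<le> ennreal ((c * r (j + n)) powr u)"
          unfolding diam_power_def using \<open>u > 0\<close> Q
          by (auto intro!: ennreal_leI powr_mono2 diameter_ge_0)
        finally show "hausdorff_premeasure u \<delta> (Q (j + n) i) \<le> ennreal ((c * r (j + n)) powr u)" .
      qed
      also have "\<dots> = ennreal (c powr u * a (j + n))"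
        using r(1)[of "j+n"] \<open>c \<ge> 0\<close>
        by (simp add: a_def powr_mult ennreal_of_nat_eq_real_of_nat ennreal_mult'[symmetric] mult_ac)
      finally show "hausdorff_premeasure u \<delta> (\<Union>i\<in>I (j + n). Q (j + n) i) \<le> ennreal (c powr u * a (j + n))" .
    qed
    also have "\<dots> = ennreal (c powr u * (\<Sum>j. a (j + n)))"
    proof -
      have s: "summable (\<lambda>j. a (j + n))"
        using sm by (intro summable_ignore_initial_segment) (simp add: a_def[abs_def])
      show ?thesis
        using a0 by (subst suminf_ennreal2) (auto simp: suminf_mult[OF s] simp del: summable_cmult_iff intro!: summable_mult s)
    qed
    also have "\<dots> \<le> ennreal e" using n(1) by (intro ennreal_leI) simp
    finally show ?thesis .
  qed
  then show "hausdorff_premeasure u \<delta> Z = 0"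
    by (metis ennreal_le_epsilon add.left_neutral le_zero_eq)
qed

section \<open>The kernel and its autocorrelation averaged over slopes\<close>

text \<open>
  The indicator of a tube of half-width 6 minus its average over the tube of half-width \<open>B\<close>, in units of the
  cell size. The factor \<open>6 / B\<close> makes the integral vanish.
\<close>

definition kern :: "real \<Rightarrow> real \<Rightarrow> real" where
  "kern B x = indicator {-6..6} x - 6 / B * indicator {-B..B} x"

definition autocorr :: "real \<Rightarrow> real \<Rightarrow> real" where
  "autocorr B w = (\<integral>y. kern B y * kern B (y - w) \<partial>lborel)"

text \<open>
  A cut-off for the slope that is at least 1 on \<open>{-1..1}\<close>. Being Lipschitz, it is nearly constant over
  the short range of slopes for which two distant cells interact.
\<close>

definition tent :: "real \<Rightarrow> real" where "tent m = max 0 (2 - \<bar>m\<bar>)"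

lemma kern_measurable [measurable]: "kern B \<in> borel_measurable borel"
  unfolding kern_def[abs_def] by measurable

lemma tent_measurable [measurable]: "tent \<in> borel_measurable borel"
  unfolding tent_def[abs_def] by measurable

lemma abs_kern_le_1: "B \<ge> 6 \<Longrightarrow> \<bar>kern B x\<bar> \<le> 1"
  by (auto simp: kern_def indicator_def)

lemma kern_outside: "B \<ge> 6 \<Longrightarrow> \<bar>x\<bar> > B \<Longrightarrow> kern B x = 0"
  by (auto simp: kern_def indicator_def)

lemma integrable_indicator_Icc: "integrable lborel (\<lambda>x. c * indicator {a..b::real} x :: real)"
  by (cases "a \<le> b") (auto intro!: integrable_mult_right integrable_real_indicator)

lemma integrable_kern [simp]: "integrable lborel (kern B)"
  unfolding kern_def[abs_def]
  using Bochner_Integration.integrable_diff[OF integrable_indicator_Icc[of 1 "-6" 6] integrable_indicator_Icc[of "6/B" "-B" B]]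
  by simp

lemma integrable_abs_kern [simp]: "integrable lborel (\<lambda>x. \<bar>kern B x\<bar>)"
  by (intro integrable_abs integrable_kern)

lemma integral_kern: "B \<ge> 6 \<Longrightarrow> (\<integral>x. kern B x \<partial>lborel) = 0"
  unfolding kern_def by (subst Bochner_Integration.integral_diff) auto

lemma integral_abs_kern: assumes "B \<ge> 6" shows "(\<integral>x. \<bar>kern B x\<bar> \<partial>lborel) \<le> 24"
proof -
  have "(\<integral>x. \<bar>kern B x\<bar> \<partial>lborel) \<le> (\<integral>x. indicator {-6..6} x + 6 / B * indicator {-B..B} x \<partial>lborel)"
    using assms Bochner_Integration.integrable_add[OF integrable_indicator_Icc[of 1 "-6" 6] integrable_indicator_Icc[of "6/B" "-B" B]]
    by (intro integral_mono integrable_abs_kern) (auto simp: kern_def indicator_def)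
  also have "\<dots> = 24" using assms
    by (subst Bochner_Integration.integral_add) auto
  finally show ?thesis .
qed

lemma integrable_kern_mult:
  assumes "B \<ge> 6" "f \<in> borel_measurable borel" "\<And>x. \<bar>f x\<bar> \<le> (1::real)"
  shows "integrable lborel (\<lambda>y. kern B y * f y)"
proof (rule Bochner_Integration.integrable_bound[OF integrable_kern[of B]])
  show "(\<lambda>y. kern B y * f y) \<in> borel_measurable lborel" using assms by measurable
  show "AE x in lborel. norm (kern B x * f x) \<le> norm (kern B x)"
    using assms(3) by (auto simp: abs_mult intro!: mult_right_le_one_le AE_I2)
qed

lemma integrable_autocorr_integrand:
  assumes "B \<ge> 6" shows "integrable lborel (\<lambda>y. kern B y * kern B (y - w))"
  by (rule integrable_kern_mult) (use assms abs_kern_le_1 in auto)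

lemma autocorr_measurable [measurable]: "autocorr B \<in> borel_measurable borel"
  unfolding autocorr_def[abs_def] by measurable

lemma abs_autocorr_le: assumes "B \<ge> 6" shows "\<bar>autocorr B w\<bar> \<le> 24"
proof -
  have "\<bar>autocorr B w\<bar> \<le> (\<integral>y. \<bar>kern B y * kern B (y - w)\<bar> \<partial>lborel)"
    unfolding autocorr_def by (rule integral_abs_bound)
  also have "\<dots> \<le> (\<integral>y. \<bar>kern B y\<bar> \<partial>lborel)"
    by (intro integral_mono integrable_abs integrable_autocorr_integrand integrable_kern)
      (use assms abs_kern_le_1 in \<open>auto simp: abs_mult intro!: mult_right_le_one_le\<close>)
  also have "\<dots> \<le> 24" using assms by (rule integral_abs_kern)
  finally show ?thesis .
qed

lemma autocorr_outside: assumes "B \<ge> 6" "\<bar>w\<bar> > 2 * B" shows "autocorr B w = 0"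
proof -
  have z: "kern B y * kern B (y - w) = 0" for y
    using kern_outside[OF assms(1), of y] kern_outside[OF assms(1), of "y - w"] assms(2) by force
  show ?thesis unfolding autocorr_def z by simp
qed

lemma integrable_autocorr_mult:
  assumes "B \<ge> 6" "f \<in> borel_measurable borel" "\<And>w. \<bar>f w\<bar> \<le> (c::real)"
  shows "integrable lborel (\<lambda>w. f w * autocorr B w)"
proof (rule Bochner_Integration.integrable_bound)
  show "integrable lborel (\<lambda>w. (c * 24) * indicator {-2*B..2*B} w :: real)"
    by (rule integrable_indicator_Icc)
  show "(\<lambda>w. f w * autocorr B w) \<in> borel_measurable lborel" using assms by measurable
  show "AE w in lborel. norm (f w * autocorr B w) \<le> norm ((c * 24) * indicator {-2*B..2*B} w :: real)"
  proof (rule AE_I2)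
    fix w
    have "0 \<le> c" using assms(3)[of 0] by simp
    show "norm (f w * autocorr B w) \<le> norm ((c * 24) * indicator {-2*B..2*B} w :: real)"
    proof (cases "\<bar>w\<bar> > 2 * B")
      case True then show ?thesis using autocorr_outside[OF assms(1)] by simp
    next
      case False
      then have "w \<in> {-2*B..2*B}" by auto
      then show ?thesis
        using mult_mono[OF assms(3)[of w] abs_autocorr_le[OF assms(1), of w]] \<open>0 \<le> c\<close> by (simp add: abs_mult)
    qed
  qed
qed

lemma integrable_autocorr: assumes "B \<ge> 6" shows "integrable lborel (autocorr B)"
  using integrable_autocorr_mult[of B "\<lambda>_. 1" 1] assms by simp

text \<open>By Fubini's theorem this is a product of two integrals of the kernel, which vanish.\<close>

lemma integral_autocorr: assumes "B \<ge> 6" shows "(\<integral>w. autocorr B w \<partial>lborel) = 0"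
proof -
  have inner: "(\<integral>w. kern B (y - w) \<partial>lborel) = 0" for y
    using lborel_integral_real_affine[of "-1" "kern B" y] integral_kern[OF assms] by simp
  have ia: "(\<integral>w. \<bar>kern B (y - w)\<bar> \<partial>lborel) = (\<integral>w. \<bar>kern B w\<bar> \<partial>lborel)" for y
    using lborel_integral_real_affine[of "-1" "\<lambda>x. \<bar>kern B x\<bar>" y] by simp
  have ig: "integrable lborel (\<lambda>w. kern B (y - w))" for y
    using lborel_integrable_real_affine[OF integrable_kern[of B], of "-1" y] by simp
  have "integrable (lborel \<Otimes>\<^sub>M lborel) (case_prod (\<lambda>y w. kern B y * kern B (y - w)))"
    by (rule lborel_pair.Fubini_integrable) (auto simp: abs_mult ia ig intro!: AE_I2 integrable_mult_left)
  from lborel_pair.Fubini_integral[OF this]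
  show ?thesis by (simp add: autocorr_def inner)
qed

lemma autocorr_shift:
  "(\<integral>x. kern B (\<alpha> - x) * kern B (\<beta> - x) \<partial>lborel) = autocorr B (\<alpha> - \<beta>)"
  using lborel_integral_real_affine[of "-1" "\<lambda>x. kern B x * kern B (x - (\<alpha> - \<beta>))" \<alpha>]
  by (simp add: autocorr_def algebra_simps)

lemma tent_bounds: "0 \<le> tent m" "tent m \<le> 2 * indicator {-2..2} m" "\<bar>tent m\<bar> \<le> 2" "tent m \<le> 2"
  by (auto simp: tent_def indicator_def)

lemma tent_lipschitz: "\<bar>tent x - tent y\<bar> \<le> \<bar>x - y\<bar>"
  by (auto simp: tent_def)

lemma integrable_tent_mult:
  assumes "f \<in> borel_measurable borel" "\<And>m. \<bar>f m\<bar> \<le> (c::real)"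
  shows "integrable lborel (\<lambda>m. tent m * f m)"
proof (rule Bochner_Integration.integrable_bound)
  show "integrable lborel (\<lambda>w. (2 * c) * indicator {-2..2::real} w :: real)"
    by (rule integrable_indicator_Icc)
  show "(\<lambda>w. tent w * f w) \<in> borel_measurable lborel" using assms by measurable
  have "\<bar>tent m\<bar> * \<bar>f m\<bar> \<le> 2 * indicator {-2..2} m * c" for m
    by (rule mult_mono) (use assms(2) tent_bounds[of m] in \<open>auto simp: indicator_def\<close>)
  then have "\<bar>tent m * f m\<bar> \<le> (2 * c) * indicator {-2..2} m" for m
    by (simp only: abs_mult mult_ac)
  then have "norm (tent m * f m) \<le> norm ((2 * c) * indicator {-2..2} m :: real)" for m
    unfolding real_norm_def using abs_ge_self order_trans by blast
  then show "AE w in lborel. norm (tent w * f w) \<le> norm ((2 * c) * indicator {-2..2} w :: real)"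
    by (rule AE_I2)
qed

lemma tent_autocorr_trivial:
  assumes "B \<ge> 6" shows "\<bar>\<integral>m. tent m * autocorr B (a - m * b) \<partial>lborel\<bar> \<le> 192"
proof -
  have "\<bar>\<integral>m. tent m * autocorr B (a - m * b) \<partial>lborel\<bar> \<le> (\<integral>m. \<bar>tent m * autocorr B (a - m * b)\<bar> \<partial>lborel)"
    by (rule integral_abs_bound)
  also have "\<dots> \<le> (\<integral>m. 48 * indicator {-2..2::real} m \<partial>lborel)"
  proof (rule integral_mono)
    show "integrable lborel (\<lambda>m. \<bar>tent m * autocorr B (a - m * b)\<bar>)"
      by (intro integrable_abs integrable_tent_mult[where c=24]) (use assms abs_autocorr_le in auto)
    show "integrable lborel (\<lambda>m. 48 * indicator {-2..2::real} m :: real)"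
      by (intro integrable_mult_right integrable_real_indicator) auto
    fix m
    have "\<bar>tent m\<bar> * \<bar>autocorr B (a - m * b)\<bar> \<le> 2 * indicator {-2..2} m * 24"
      by (rule mult_mono) (use tent_bounds[of m] abs_autocorr_le assms in auto)
    then show "\<bar>tent m * autocorr B (a - m * b)\<bar> \<le> 48 * indicator {-2..2::real} m"
      by (simp add: abs_mult)
  qed
  also have "\<dots> = 192" by simp
  finally show ?thesis .
qed

text \<open>The cut-off admits only slopes below 2, for which \<open>a - m * b\<close> is too large for a common tube.\<close>

lemma tent_autocorr_zero:
  assumes "B \<ge> 6" "\<bar>a\<bar> > 2 * \<bar>b\<bar> + 2 * B" shows "(\<integral>m. tent m * autocorr B (a - m * b) \<partial>lborel) = 0"
proof -
  have z: "tent m * autocorr B (a - m * b) = 0" for m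
  proof (cases "\<bar>m\<bar> \<le> 2")
    case True
    then have "\<bar>m * b\<bar> \<le> 2 * \<bar>b\<bar>" by (simp add: abs_mult mult_right_mono)
    then have "\<bar>a - m * b\<bar> > 2 * B" using assms by linarith
    then show ?thesis using autocorr_outside assms by simp
  next
    case False then show ?thesis by (simp add: tent_def)
  qed
  show ?thesis unfolding z by simp
qed

text \<open>
  Substituting \<open>w = a - m * b\<close> gives one factor \<open>1 / \<bar>b\<bar>\<close>. The second one is the cancellation: since the
  autocorrelation integrates to 0, the cut-off may be replaced by its increment over the support, where
  the slope varies by at most \<open>2 * B / \<bar>b\<bar>\<close>.
\<close>

lemma tent_autocorr_decay:
  assumes B: "B \<ge> 6" and b: "b \<noteq> 0"
  shows "\<bar>\<integral>m. tent m * autocorr B (a - m * b) \<partial>lborel\<bar> \<le> 192 * B\<^sup>2 / b\<^sup>2"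
proof -
  have bd: "\<bar>tent ((a - w) / b) * autocorr B w - tent (a / b) * autocorr B w\<bar>
      \<le> 48 * B / \<bar>b\<bar> * indicator {-2*B..2*B} w" for w
  proof (cases "\<bar>w\<bar> > 2 * B")
    case True then show ?thesis using B autocorr_outside[OF B True] by simp
  next
    case False
    have "\<bar>tent ((a - w) / b) - tent (a / b)\<bar> \<le> \<bar>(a - w) / b - a / b\<bar>" by (rule tent_lipschitz)
    also have "\<dots> = \<bar>w\<bar> / \<bar>b\<bar>" by (simp add: diff_divide_distrib)
    also have "\<dots> \<le> 2 * B / \<bar>b\<bar>" using False by (intro divide_right_mono) auto
    finally have "\<bar>tent ((a - w) / b) - tent (a / b)\<bar> * \<bar>autocorr B w\<bar> \<le> 2 * B / \<bar>b\<bar> * 24"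
      by (rule mult_mono) (use B abs_autocorr_le in auto)
    moreover have "w \<in> {-2*B..2*B}" using False by auto
    ultimately show ?thesis by (simp add: abs_mult[symmetric] left_diff_distrib)
  qed
  have i1: "integrable lborel (\<lambda>w. tent ((a - w) / b) * autocorr B w)"
    by (rule integrable_autocorr_mult[OF B, where c=2]) (auto simp: tent_bounds)
  have i2: "integrable lborel (\<lambda>w. tent (a / b) * autocorr B w)"
    by (intro integrable_mult_right integrable_autocorr B)
  define X where "X = (\<integral>m. tent m * autocorr B (a - m * b) \<partial>lborel)"
  have e1: "(\<integral>w. tent ((a - w) / b) * autocorr B w \<partial>lborel) = \<bar>b\<bar> * X"
    using lborel_integral_real_affine[of "-b" "\<lambda>w. tent ((a - w) / b) * autocorr B w" a] b
    by (simp add: mult.commute[of b] X_def)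
  have e2: "(\<integral>w. tent ((a - w) / b) * autocorr B w - tent (a / b) * autocorr B w \<partial>lborel) = \<bar>b\<bar> * X"
    by (subst Bochner_Integration.integral_diff[OF i1 i2]) (simp add: integral_autocorr[OF B] e1)
  have "\<bar>\<integral>w. tent ((a - w) / b) * autocorr B w - tent (a / b) * autocorr B w \<partial>lborel\<bar>
     \<le> (\<integral>w. 48 * B / \<bar>b\<bar> * indicator {-2*B..2*B} w \<partial>lborel)"
    by (rule order_trans[OF integral_abs_bound integral_mono[OF
        integrable_abs[OF Bochner_Integration.integrable_diff[OF i1 i2]] integrable_indicator_Icc bd]])
  also have "\<dots> = 192 * B\<^sup>2 / \<bar>b\<bar>"
    using B by (simp add: power2_eq_square)
  finally have "\<bar>b\<bar> * \<bar>X\<bar> \<le> 192 * B\<^sup>2 / \<bar>b\<bar>"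
    unfolding e2 by (simp only: abs_mult abs_abs)
  then have "\<bar>X\<bar> \<le> 192 * B\<^sup>2 / \<bar>b\<bar> / \<bar>b\<bar>"
    using b by (subst pos_le_divide_eq) (simp_all add: mult.commute)
  also have "\<dots> = 192 * B\<^sup>2 / b\<^sup>2"
    by (simp add: power2_eq_square)
  finally show ?thesis by (simp add: X_def)
qed

section \<open>The second moment of the fluctuations\<close>

text \<open>
  The position of the tube of slope \<open>m\<close> through a cell, where cells are indexed by integer
  pairs and the cell size is the unit of length.
\<close>

definition shear :: "real \<Rightarrow> int \<times> int \<Rightarrow> real" where
  "shear m k = real_of_int (fst k) - m * real_of_int (snd k)"

definition fluct :: "real \<Rightarrow> (int \<times> int) set \<Rightarrow> real \<Rightarrow> real \<Rightarrow> real" where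
  "fluct B P m x = (\<Sum>k\<in>P. kern B (shear m k - x))"

definition energy :: "real \<Rightarrow> (int \<times> int) set \<Rightarrow> real \<Rightarrow> real" where
  "energy B P m = (\<integral>x. (fluct B P m x)\<^sup>2 \<partial>lborel)"

lemma fluct_power2:
  "(fluct B P m x)\<^sup>2 = (\<Sum>k\<in>P. \<Sum>l\<in>P. kern B (shear m k - x) * kern B (shear m l - x))"
  by (simp add: fluct_def power2_eq_square sum_product)

lemma integrable_kern_pair:
  assumes "B \<ge> 6"
  shows "integrable lborel (\<lambda>x. kern B (\<alpha> - x) * kern B (\<beta> - x))"
  using lborel_integrable_real_affine[OF integrable_autocorr_integrand[OF assms, of "\<alpha> - \<beta>"], of "-1" \<alpha>]
  by (simp add: algebra_simps)

lemma integrable_fluct_power2: "B \<ge> 6 \<Longrightarrow> integrable lborel (\<lambda>x. (fluct B P m x)\<^sup>2)"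
  unfolding fluct_power2 by (intro Bochner_Integration.integrable_sum integrable_kern_pair)

lemma energy_eq:
  assumes "B \<ge> 6"
  shows "energy B P m = (\<Sum>k\<in>P. \<Sum>l\<in>P. autocorr B (real_of_int (fst k - fst l) - m * real_of_int (snd k - snd l)))"
proof -
  have "energy B P m = (\<Sum>k\<in>P. \<Sum>l\<in>P. autocorr B (shear m k - shear m l))"
    unfolding energy_def fluct_power2 using assms
    by (simp add: Bochner_Integration.integral_sum integrable_kern_pair autocorr_shift)
  then show ?thesis by (simp add: shear_def algebra_simps)
qed

lemma energy_nonneg: "energy B P m \<ge> 0"
  unfolding energy_def by simp

lemma integrable_tent_energy: "B \<ge> 6 \<Longrightarrow> integrable lborel (\<lambda>m. tent m * energy B P m)"
  unfolding energy_eq sum_distrib_left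
  by (intro Bochner_Integration.integrable_sum integrable_tent_mult[where c=24]) (auto intro: abs_autocorr_le)

lemma harm_le_Suc_ln: "M \<ge> 1 \<Longrightarrow> harm M \<le> (1 + ln (real M) :: real)"
  using decseqD[OF decseq_harm_diff_ln, of 0 "M - 1"] by (cases M) (auto simp: harm_def)

lemma sum_symmetric_harm:
  "(\<Sum>n\<in>{- int M..int M}. if n = 0 then 1 else 1 / \<bar>real_of_int n\<bar>) = 1 + 2 * harm M"
proof (induction M)
  case 0 then show ?case by (simp add: harm_def)
next
  case (Suc M)
  have "{- int (Suc M)..int (Suc M)} = insert (int (Suc M)) (insert (- int (Suc M)) {- int M..int M})"
    by auto
  then show ?case using Suc by (simp add: harm_Suc field_simps)
qed

text \<open>
  The number of cells in a row at distance \<open>n\<close> that can share a tube with a given cell, times the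
  bound on each interaction; here \<open>1728 = 9 * 192\<close>.
\<close>

lemma row_weight_bound:
  fixes b :: nat and n :: int
  assumes "b \<ge> 6" "n \<noteq> 0"
  shows "(4 * \<bar>real_of_int n\<bar> + 4 * b + 1) * (192 * (real b)\<^sup>2 / (real_of_int n)\<^sup>2) \<le> 1728 * real b ^ 3 * (1 / \<bar>real_of_int n\<bar>)"
proof -
  define N where "N = \<bar>real_of_int n\<bar>"
  have N: "N \<ge> 1" using assms(2) by (simp add: N_def)
  have n2: "(real_of_int n)\<^sup>2 = N\<^sup>2" by (simp add: N_def)
  have "N \<le> real b * N" "real b \<le> real b * N" "1 \<le> real b * N"
    using N assms(1) mult_mono[of 1 "real b" 1 N] by auto
  then have "4 * N + 4 * b + 1 \<le> 9 * (b * N)" by linarith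
  then have "(4 * N + 4 * b + 1) * (192 * (real b)\<^sup>2 / N\<^sup>2) \<le> 9 * (b * N) * (192 * (real b)\<^sup>2 / N\<^sup>2)"
    by (rule mult_right_mono) simp
  also have "\<dots> = 1728 * real b ^ 3 * (1 / N)"
    using N by (simp add: field_simps power2_eq_square power3_eq_cube)
  finally show ?thesis unfolding n2 N_def .
qed

text \<open>
  Expanding the square gives the interactions of all pairs of cells. For a fixed cell the rows at distance
  \<open>n\<close> contribute \<open>O(1 / n)\<close> each, hence a logarithm of the number \<open>M\<close> of rows in total; the bound is linear in
  the number of cells.
\<close>

lemma tent_energy_bound:
  fixes b M :: nat
  assumes b: "b \<ge> 6" and M: "M \<ge> 1" and P: "finite P"
    and spread: "\<And>k l. k \<in> P \<Longrightarrow> l \<in> P \<Longrightarrow> \<bar>snd k - snd l\<bar> \<le> int M"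
  shows "(\<integral>m. tent m * energy b P m \<partial>lborel) \<le> 1728 * real b ^ 3 * (3 + 2 * ln (real M)) * real (card P)"
proof -
  have B: "real b \<ge> 6" using b by simp
  define J where "J k l = (\<integral>m. tent m * autocorr b (real_of_int (fst k - fst l) - m * real_of_int (snd k - snd l)) \<partial>lborel)"
    for k l :: "int \<times> int"
  define v where "v n = (if n = 0 then 192 else 192 * (real b)\<^sup>2 / (real_of_int n)\<^sup>2)" for n :: int
  define R where "R n = {- (2 * \<bar>n\<bar> + 2 * int b)..2 * \<bar>n\<bar> + 2 * int b}" for n :: int
  have v0: "v n \<ge> 0" for n by (simp add: v_def)
  have Jv: "\<bar>J k l\<bar> \<le> v (snd k - snd l)" for k l
  proof (cases "snd k - snd l = 0")
    case True
    have "\<bar>J k l\<bar> \<le> 192" unfolding J_def by (rule tent_autocorr_trivial[OF B])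
    then show ?thesis using True by (simp add: v_def)
  next
    case False
    then have "real_of_int (snd k - snd l) \<noteq> 0" by linarith
    then have "\<bar>J k l\<bar> \<le> 192 * (real b)\<^sup>2 / (real_of_int (snd k - snd l))\<^sup>2"
      unfolding J_def by (rule tent_autocorr_decay[OF B])
    then show ?thesis using False by (simp add: v_def)
  qed
  have J0: "J k l = 0" if "fst k - fst l \<notin> R (snd k - snd l)" for k l
  proof -
    have "2 * \<bar>snd k - snd l\<bar> + 2 * int b < \<bar>fst k - fst l\<bar>" using that unfolding R_def atLeastAtMost_iff by linarith
    then have "real_of_int (2 * \<bar>snd k - snd l\<bar> + 2 * int b) < real_of_int \<bar>fst k - fst l\<bar>"
      by (simp only: of_int_less_iff)
    then show ?thesis unfolding J_def by (intro tent_autocorr_zero[OF B]) simp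
  qed
  have row: "(\<Sum>l\<in>P. \<bar>J k l\<bar>) \<le> 1728 * real b ^ 3 * (3 + 2 * ln (real M))" if k: "k \<in> P" for k
  proof -
    define h where "h l = (snd k - snd l, fst k - fst l)" for l :: "int \<times> int"
    define T where "T = Sigma {- int M..int M} R"
    define P' where "P' = {l\<in>P. h l \<in> T}"
    have "(\<Sum>l\<in>P. \<bar>J k l\<bar>) = (\<Sum>l\<in>P'. \<bar>J k l\<bar>)"
    proof (rule sum.mono_neutral_right)
      show "\<forall>l\<in>P - P'. \<bar>J k l\<bar> = 0"
      proof
        fix l assume l: "l \<in> P - P'"
        then have "snd k - snd l \<in> {- int M..int M}" using spread[OF k, of l] by auto
        then have "fst k - fst l \<notin> R (snd k - snd l)" using l by (auto simp: P'_def T_def h_def)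
        then show "\<bar>J k l\<bar> = 0" using J0 by simp
      qed
    qed (use P in \<open>auto simp: P'_def\<close>)
    also have "\<dots> \<le> (\<Sum>l\<in>P'. v (fst (h l)))" by (intro sum_mono) (use Jv in \<open>simp add: h_def\<close>)
    also have "\<dots> = (\<Sum>p\<in>h ` P'. v (fst p))"
      by (subst sum.reindex) (auto simp: inj_on_def h_def prod_eq_iff)
    also have "\<dots> \<le> (\<Sum>p\<in>T. v (fst p))"
      by (rule sum_mono2) (auto simp: T_def R_def P'_def v0)
    also have "\<dots> = (\<Sum>n\<in>{- int M..int M}. \<Sum>a\<in>R n. v n)"
      unfolding T_def by (subst sum.Sigma) (auto simp: R_def case_prod_beta)
    also have "\<dots> = (\<Sum>n\<in>{- int M..int M}. (4 * \<bar>real_of_int n\<bar> + 4 * b + 1) * v n)"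
      by (rule sum.cong) (auto simp: R_def algebra_simps)
    also have "\<dots> \<le> (\<Sum>n\<in>{- int M..int M}. 1728 * real b ^ 3 * (if n = 0 then 1 else 1 / \<bar>real_of_int n\<bar>))"
    proof (rule sum_mono)
      fix n :: int
      show "(4 * \<bar>real_of_int n\<bar> + 4 * b + 1) * v n \<le> 1728 * real b ^ 3 * (if n = 0 then 1 else 1 / \<bar>real_of_int n\<bar>)"
      proof (cases "n = 0")
        case True
        have "real b \<le> real b ^ 3" using B by (intro self_le_power) auto
        moreover have "(4 * \<bar>real_of_int n\<bar> + 4 * b + 1) * v n = 768 * real b + 192" using True by (simp add: v_def)
        moreover have "1728 * real b ^ 3 * (if n = 0 then 1 else 1 / \<bar>real_of_int n\<bar>) = 1728 * real b ^ 3" using True by simp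
        ultimately show ?thesis using B by linarith
      next
        case False then show ?thesis using row_weight_bound[OF b False] by (simp add: v_def)
      qed
    qed
    also have "\<dots> = 1728 * real b ^ 3 * (1 + 2 * harm M)"
      by (simp only: sum_distrib_left[symmetric] sum_symmetric_harm)
    also have "\<dots> \<le> 1728 * real b ^ 3 * (3 + 2 * ln (real M))"
      using harm_le_Suc_ln[OF M] by (intro mult_left_mono) auto
    finally show ?thesis .
  qed
  have "(\<integral>m. tent m * energy b P m \<partial>lborel) = (\<Sum>k\<in>P. \<Sum>l\<in>P. J k l)"
    unfolding energy_eq[OF B] sum_distrib_left J_def using B
    by (subst Bochner_Integration.integral_sum
       | intro sum.cong refl Bochner_Integration.integrable_sum integrable_tent_mult[where c=24] | simp add: abs_autocorr_le)+
  also have "\<dots> \<le> (\<Sum>k\<in>P. \<Sum>l\<in>P. \<bar>J k l\<bar>)" by (intro sum_mono) auto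
  also have "\<dots> \<le> (\<Sum>k\<in>P. 1728 * real b ^ 3 * (3 + 2 * ln (real M)))" by (intro sum_mono row)
  finally show ?thesis by (simp add: mult.commute)
qed

section \<open>Cells in unusually rich tubes\<close>

definition window_count :: "real \<Rightarrow> (int \<times> int) set \<Rightarrow> real \<Rightarrow> real \<Rightarrow> nat" where
  "window_count m P w x = card {l \<in> P. \<bar>shear m l - x\<bar> \<le> w}"

text \<open>
  Since \<open>fluct\<close> is the count in the window minus the prediction from the wider window, the last
  condition says that the count is at least twice the prediction. It is asked for on a whole interval of
  positions, which makes it visible to integrals over \<open>x\<close>; at all these positions the window 6 contains the window 5
  around the cell.
\<close>

definition bad_cells :: "real \<Rightarrow> (int \<times> int) set \<Rightarrow> real \<Rightarrow> real \<Rightarrow> (int \<times> int) set" where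
  "bad_cells B P m L = {k \<in> P. L \<le> real (window_count m P 5 (shear m k)) \<and>
     (\<forall>x. \<bar>x - shear m k\<bar> \<le> 1 \<longrightarrow> real (window_count m P 6 x) \<le> 2 * fluct B P m x)}"

lemma window_count_sum:
  "finite P \<Longrightarrow> real (window_count m P w x) = (\<Sum>l\<in>P. indicator {-w..w} (shear m l - x))"
  unfolding window_count_def
  by (subst card_eq_sum) (simp add: indicator_def sum.If_cases Int_def of_bool_def abs_le_iff; rule arg_cong[where f=card]; force)

lemma window_count_mono:
  assumes "finite P" "w + \<bar>x - y\<bar> \<le> w'"
  shows "window_count m P w x \<le> window_count m P w' y"
  unfolding window_count_def by (rule card_mono) (use assms in auto)

lemma fluct_eq:
  assumes "finite P"
  shows "fluct B P m x = real (window_count m P 6 x) - 6 / B * real (window_count m P B x)"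
  unfolding window_count_sum[OF assms] fluct_def kern_def sum_subtractf sum_distrib_left by simp

text \<open>
  Chebyshev's inequality. Around a bad cell the fluctuation is at least half the count \<open>F\<close>, and \<open>F\<close> is at
  least \<open>L\<close> and at least the number \<open>n\<close> of nearby bad cells. So its square exceeds \<open>L * n / 4\<close>, whose integral counts every bad cell
  with weight \<open>L / 2\<close>.
\<close>

lemma card_bad_cells_le:
  assumes P: "finite P" and B: "B \<ge> 6" and lam: "L > 0"
  shows "L * real (card (bad_cells B P m L)) \<le> 2 * energy B P m"
proof -
  define X where "X = bad_cells B P m L"
  have X: "finite X" "X \<subseteq> P" using P by (auto simp: X_def bad_cells_def)
  define n where "n x = (\<Sum>k\<in>X. indicator {shear m k - 1..shear m k + 1} x :: real)" for x
  have n_card: "n x = real (card {k\<in>X. \<bar>x - shear m k\<bar> \<le> 1})" for x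
    unfolding n_def using X(1)
    by (subst card_eq_sum) (simp add: indicator_def sum.If_cases Int_def of_bool_def abs_le_iff; rule arg_cong[where f=card]; force)
  have pt: "L / 4 * n x \<le> (fluct B P m x)\<^sup>2" for x
  proof (cases "{k\<in>X. \<bar>x - shear m k\<bar> \<le> 1} = {}")
    case True then show ?thesis unfolding n_card True by simp
  next
    case False
    then obtain k where k: "k \<in> X" "\<bar>x - shear m k\<bar> \<le> 1" by auto
    define F where "F = real (window_count m P 6 x)"
    have "F \<le> 2 * fluct B P m x" using k by (auto simp: X_def bad_cells_def F_def)
    then have "(F / 2)\<^sup>2 \<le> (fluct B P m x)\<^sup>2" by (intro power_mono) (auto simp: F_def)
    moreover have "L \<le> F"
    proof -
      have "L \<le> real (window_count m P 5 (shear m k))" using k by (auto simp: X_def bad_cells_def)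
      also have "\<dots> \<le> F" unfolding F_def using k(2) by (intro of_nat_mono window_count_mono P) auto
      finally show ?thesis .
    qed
    moreover have "n x \<le> F"
      unfolding n_card F_def window_count_def using X P by (intro of_nat_mono card_mono) auto
    ultimately have "L * n x \<le> F * F" using lam by (intro mult_mono) (auto simp: n_card)
    then show ?thesis using \<open>(F / 2)\<^sup>2 \<le> (fluct B P m x)\<^sup>2\<close> by (simp add: power2_eq_square)
  qed
  have int_n: "integrable lborel n" "integral\<^sup>L lborel n = 2 * real (card X)"
    using integrable_indicator_Icc[of 1]
    by (auto simp: n_def[abs_def] intro!: Bochner_Integration.integrable_sum)
  have "L / 4 * integral\<^sup>L lborel n = (\<integral>x. L / 4 * n x \<partial>lborel)" by simp
  also have "\<dots> \<le> energy B P m"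
    unfolding energy_def by (intro integral_mono integrable_fluct_power2 B pt integrable_mult_right int_n)
  finally show ?thesis by (simp add: int_n X_def)
qed

definition parent :: "nat \<Rightarrow> int \<times> int \<Rightarrow> int \<times> int" where
  "parent b k = (fst k div int b, snd k div int b)"

text \<open>
  The bound is \<open>2 * (b - 1)\<close> and not \<open>2 * b\<close>, because integer remainders are at most \<open>b - 1\<close>. This
  margin lets \<open>good_cell_step\<close> use the same window 5 at both scales.
\<close>

lemma shear_parent:
  assumes "\<bar>m\<bar> \<le> 1" "b \<ge> 1"
  shows "\<bar>real b * shear m (parent b k) - shear m k\<bar> \<le> 2 * (real b - 1)"
proof -
  have *: "\<bar>real b * real_of_int (i div int b) - real_of_int i\<bar> \<le> real b - 1" for i
  proof -
    have "real_of_int i = real b * real_of_int (i div int b) + real_of_int (i mod int b)"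
      by (metis mult_div_mod_eq of_int_add of_int_mult of_int_of_nat_eq)
    moreover have "0 \<le> i mod int b" "i mod int b \<le> int b - 1" using assms(2) by auto
    then have "0 \<le> real_of_int (i mod int b)" "real_of_int (i mod int b) \<le> real b - 1"
      by linarith+
    ultimately show ?thesis by linarith
  qed
  have "\<bar>m\<bar> * \<bar>real b * real_of_int (snd k div int b) - real_of_int (snd k)\<bar> \<le> 1 * (real b - 1)"
    using assms * by (intro mult_mono) auto
  then have "\<bar>m * (real b * real_of_int (snd k div int b) - real_of_int (snd k))\<bar> \<le> real b - 1"
    by (simp add: abs_mult)
  with *[of "fst k"] show ?thesis
    unfolding shear_def parent_def fst_conv snd_conv by (simp add: algebra_simps abs_le_iff)
qed

text \<open>
  If a rich cell is not bad, some nearby position sees at most twice the count predicted by the wide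
  window. The parents of the cells in the wide window lie in the window of the parent of \<open>k\<close>,
  and none of them has more than \<open>C\<close> times the average number of children.
\<close>

lemma good_cell_step:
  fixes C :: real
  assumes P: "finite P" and m: "\<bar>m\<bar> \<le> 1" and b: "b \<ge> 6" and lam: "L \<le> real (window_count m P 5 (shear m k))"
    and k: "k \<in> P" "k \<notin> bad_cells b P m L"
    and C: "\<And>p. p \<in> parent b ` P \<Longrightarrow> real (card (parent b ` P)) * real (card {l\<in>P. parent b l = p}) \<le> C * real (card P)"
  shows "real (window_count m P 5 (shear m k)) / real (card P)
    \<le> 12 * C / real b * (real (window_count m (parent b ` P) 5 (shear m (parent b k))) / real (card (parent b ` P)))"
proof -
  define N where "N = real (card P)"
  define N' where "N' = real (card (parent b ` P))"
  have pos: "N > 0" "N' > 0" using k P by (auto simp: N_def N'_def card_gt_0_iff)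
  define W where "W = {p \<in> parent b ` P. \<bar>shear m p - shear m (parent b k)\<bar> \<le> 5}"
  obtain x where x: "\<bar>x - shear m k\<bar> \<le> 1" "real (window_count m P 6 x) > 2 * fluct b P m x"
    using k lam unfolding bad_cells_def by force
  have "real (window_count m P 5 (shear m k)) \<le> real (window_count m P 6 x)"
    using x(1) by (intro of_nat_mono window_count_mono P) auto
  also have "\<dots> \<le> 12 / b * real (window_count m P b x)"
    using x(2) unfolding fluct_eq[OF P] by simp
  finally have 1: "real (window_count m P 5 (shear m k)) \<le> 12 / b * real (window_count m P b x)" .
  have "real (window_count m P b x) \<le> (\<Sum>p\<in>W. real (card {l\<in>P. parent b l = p}))"
  proof -
    have "{l \<in> P. \<bar>shear m l - x\<bar> \<le> real b} \<subseteq> (\<Union>p\<in>W. {l\<in>P. parent b l = p})"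
    proof
      fix l assume l: "l \<in> {l \<in> P. \<bar>shear m l - x\<bar> \<le> real b}"
      have "\<bar>real b * (shear m (parent b l) - shear m (parent b k))\<bar> \<le> real b * 5"
        using shear_parent[OF m, of b l] shear_parent[OF m, of b k] b l[unfolded mem_Collect_eq, THEN conjunct2] x(1)
        unfolding right_diff_distrib by linarith
      then have "\<bar>shear m (parent b l) - shear m (parent b k)\<bar> \<le> 5"
        using b by (simp add: abs_mult)
      then show "l \<in> (\<Union>p\<in>W. {l\<in>P. parent b l = p})" using l by (auto simp: W_def)
    qed
    then have "window_count m P b x \<le> card (\<Union>p\<in>W. {l\<in>P. parent b l = p})"
      unfolding window_count_def using P by (intro card_mono finite_subset[OF _ P]) auto
    also have "\<dots> \<le> (\<Sum>p\<in>W. card {l\<in>P. parent b l = p})"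
      using P by (intro card_UN_le) (auto simp: W_def)
    finally show ?thesis by (simp only: of_nat_le_iff of_nat_sum[symmetric])
  qed
  also have "\<dots> \<le> (\<Sum>p\<in>W. C * N / N')"
    using C pos by (intro sum_mono) (auto simp: W_def N_def N'_def field_simps)
  also have "\<dots> = real (window_count m (parent b ` P) 5 (shear m (parent b k))) * (C * N / N')"
    by (simp add: W_def window_count_def)
  finally have "12 / b * real (window_count m P b x)
      \<le> 12 / b * (real (window_count m (parent b ` P) 5 (shear m (parent b k))) * (C * N / N'))"
    by (intro mult_left_mono) auto
  with 1 have "real (window_count m P 5 (shear m k)) / N
      \<le> 12 / b * (real (window_count m (parent b ` P) 5 (shear m (parent b k))) * (C * N / N')) / N"
    using pos by (intro divide_right_mono) auto
  also have "\<dots> = 12 * C / b * (real (window_count m (parent b ` P) 5 (shear m (parent b k))) / N')"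
    using pos by simp
  finally show ?thesis unfolding N_def N'_def .
qed

section \<open>Refining grids\<close>

text \<open>
  The cells of a sub-uniformly distributed set in the \<open>b\<close>-adic grids. The constant \<open>D\<close> bounds the
  diameter of the set, so that there are \<open>O(b\<^sup>j)\<close> rows at scale \<open>j\<close>.
\<close>

locale cell_tree =
  fixes b D :: nat and C :: real and P :: "nat \<Rightarrow> (int \<times> int) set"
  assumes b6: "b \<ge> 6" and D1: "D \<ge> 1"
    and fin: "finite (P j)"
    and ne: "P j \<noteq> {}"
    and parents: "parent b ` P (Suc j) = P j"
    and spread: "k \<in> P j \<Longrightarrow> l \<in> P j \<Longrightarrow> \<bar>snd k - snd l\<bar> \<le> int (D * b ^ j)"
    and unif: "p \<in> P j \<Longrightarrow> real (card (P j)) * real (card {l\<in>P (Suc j). parent b l = p}) \<le> C * real (card (P (Suc j)))"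
begin

lemma bR: "real b \<ge> 6" using b6 by simp

lemma card_pos: "real (card (P j)) > 0" using fin ne by (simp add: card_gt_0_iff)

text \<open>
  A typical tube contains about \<open>card (P j) / b ^ j\<close> cells; the level asks for \<open>b powr (j * h)\<close> times as
  many.
\<close>

definition level :: "nat \<Rightarrow> real \<Rightarrow> real" where
  "level j h = real (card (P j)) * real b powr (real j * (h - 1))"

lemma level_pos: "level j h > 0" unfolding level_def using card_pos bR by simp

definition bad :: "real \<Rightarrow> nat \<Rightarrow> real \<Rightarrow> (int \<times> int) set" where
  "bad h j m = bad_cells b (P j) m (level j h)"

lemma finite_bad: "finite (bad h j m)"
  using fin by (auto simp: bad_def bad_cells_def)

text \<open>
  By \<open>tent_energy_bound\<close> the expected number of bad cells is \<open>O(j * b powr (j * (1 - h)))\<close>. The weight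
  \<open>b powr (- j * u)\<close> makes the sum over \<open>j\<close> of the expectations finite, so the sum itself is finite
  for almost every slope.
\<close>

lemma summable_bad:
  assumes u: "u > 1 - h"
  shows "AE m in lborel. \<bar>m\<bar> \<le> 1 \<longrightarrow> summable (\<lambda>j. real (card (bad h j m)) * ((1 / real b) ^ j) powr u)"
proof -
  define w where "w j = real b powr (- real j * u) / level j h" for j
  have w0: "w j \<ge> 0" for j using level_pos[of j h] by (simp add: w_def)
  define g where "g j m = w j * (tent m * energy b (P j) m)" for j m
  have g0: "g j m \<ge> 0" for j m unfolding g_def by (intro mult_nonneg_nonneg w0 tent_bounds energy_nonneg)
  have gi: "integrable lborel (g j)" for j unfolding g_def[abs_def] by (intro integrable_mult_right integrable_tent_energy bR)
  define q where "q = real b powr (1 - h - u)"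
  have "real b powr (1 - h - u) < real b powr 0" using u bR by (intro powr_less_mono) auto
  then have q: "0 < q" "q < 1" using bR by (auto simp: q_def)
  define c where "c = 1728 * real b ^ 3"
  have I: "(\<integral>m. g j m \<partial>lborel) \<le> c * ((3 + 2 * ln (real D)) + 2 * ln (real b) * real j) * q ^ j" for j
  proof -
    have "(\<integral>m. tent m * energy b (P j) m \<partial>lborel) \<le> c * (3 + 2 * ln (real (D * b ^ j))) * real (card (P j))"
      unfolding c_def by (rule tent_energy_bound) (use b6 D1 fin spread in auto)
    also have "ln (real (D * b ^ j)) = ln (real D) + real j * ln (real b)"
      using D1 bR by (simp add: ln_mult ln_realpow)
    finally have "(\<integral>m. g j m \<partial>lborel) \<le> w j * (c * (3 + 2 * (ln (real D) + real j * ln (real b))) * real (card (P j)))"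
      unfolding g_def using w0 by (simp add: mult_left_mono)
    also have "\<dots> = c * ((3 + 2 * ln (real D)) + 2 * ln (real b) * real j) * (w j * real (card (P j)))"
      by (simp add: algebra_simps)
    also have "w j * real (card (P j)) = q ^ j"
    proof -
      have "w j * real (card (P j)) = real b powr (- real j * u) / real b powr (real j * (h - 1))"
        using card_pos[of j] by (simp add: w_def level_def)
      also have "\<dots> = real b powr (- real j * u - real j * (h - 1))"
        by (rule powr_diff[symmetric])
      also have "- real j * u - real j * (h - 1) = (1 - h - u) * real j" by (simp add: algebra_simps)
      also have "real b powr ((1 - h - u) * real j) = q ^ j"
        using bR by (simp add: q_def powr_powr[symmetric] powr_realpow)
      finally show ?thesis .
    qed
    finally show ?thesis .
  qed
  have sq: "summable (\<lambda>j. c * ((3 + 2 * ln (real D)) + 2 * ln (real b) * real j) * q ^ j)"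
  proof -
    have "summable (\<lambda>j. q ^ j)" using q by (simp add: summable_geometric_iff)
    moreover have "summable (\<lambda>j. real (Suc j) * q ^ j - q ^ j)"
      using geometric_deriv_sums[of q] q calculation by (intro summable_diff) (auto simp: sums_iff)
    then have "summable (\<lambda>j. real j * q ^ j)" by (simp add: algebra_simps)
    ultimately have "summable (\<lambda>j. c * (3 + 2 * ln (real D)) * q ^ j + c * (2 * ln (real b)) * (real j * q ^ j))"
      by (intro summable_add summable_mult)
    moreover have "(\<lambda>j. c * (3 + 2 * ln (real D)) * q ^ j + c * (2 * ln (real b)) * (real j * q ^ j))
      = (\<lambda>j. c * ((3 + 2 * ln (real D)) + 2 * ln (real b) * real j) * q ^ j)"
      by (simp add: algebra_simps)
    ultimately show ?thesis by simp
  qed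
  have sI: "summable (\<lambda>j. \<integral>m. g j m \<partial>lborel)"
    by (rule summable_comparison_test'[OF sq, of 0]) (use I g0 in \<open>auto simp: integral_nonneg_AE\<close>)
  have "(\<integral>\<^sup>+m. (\<Sum>j. ennreal (g j m)) \<partial>lborel) = (\<Sum>j. \<integral>\<^sup>+m. ennreal (g j m) \<partial>lborel)"
    by (rule nn_integral_suminf) (use gi in measurable)
  also have "\<dots> = (\<Sum>j. ennreal (\<integral>m. g j m \<partial>lborel))"
    by (intro suminf_cong nn_integral_eq_integral gi) (auto simp: g0)
  also have "\<dots> \<noteq> \<infinity>"
    using sI g0 by (subst suminf_ennreal2) (auto intro!: integral_nonneg_AE)
  finally have "AE m in lborel. (\<Sum>j. ennreal (g j m)) \<noteq> \<infinity>"
    by (intro nn_integral_PInf_AE borel_measurable_suminf) (use gi in measurable)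
  then show ?thesis
  proof (rule AE_mp, intro AE_I2 impI)
    fix m :: real assume fin: "(\<Sum>j. ennreal (g j m)) \<noteq> \<infinity>" and m: "\<bar>m\<bar> \<le> 1"
    then have sg: "summable (\<lambda>j. g j m)"
      using g0 by (intro summable_suminf_not_top) auto
    show "summable (\<lambda>j. real (card (bad h j m)) * ((1 / real b) ^ j) powr u)"
    proof (rule summable_comparison_test'[OF summable_mult[OF sg, of 2], of 0])
      fix j :: nat
      have "level j h * real (card (bad h j m)) \<le> 2 * energy b (P j) m"
        unfolding bad_def by (rule card_bad_cells_le) (use cell_tree.fin[OF cell_tree_axioms] bR level_pos in auto)
      also have "\<dots> \<le> 2 * (tent m * energy b (P j) m)"
        using m energy_nonneg[of b "P j" m] mult_right_mono[of 1 "tent m" "energy b (P j) m"] by (auto simp: tent_def)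
      finally have "real (card (bad h j m)) \<le> 2 * (tent m * energy b (P j) m) / level j h"
        using level_pos[of j h] by (simp add: field_simps)
      then have "real (card (bad h j m)) * real b powr (- real j * u) \<le> 2 * (tent m * energy b (P j) m) / level j h * real b powr (- real j * u)"
        by (rule mult_right_mono) simp
      also have "\<dots> = 2 * g j m" by (simp add: g_def w_def)
      also have "real b powr (- real j * u) = ((1 / real b) ^ j) powr u"
        using bR by (simp add: power_one_over powr_divide powr_realpow[symmetric] powr_powr powr_minus_divide)
      finally show "norm (real (card (bad h j m)) * ((1 / real b) ^ j) powr u) \<le> 2 * g j m" by simp
    qed
  qed
qed

text \<open>
  Otherwise \<open>good_cell_step\<close> applies at all scales after some \<open>j0\<close>, as long as the density \<open>G\<close> stays
  above the level \<open>h\<close>. Going down from a scale \<open>j\<close> of level \<open>h' > h\<close>, the density loses at most the factor that the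
  level \<open>h\<close> loses, so it stays above that level, and at the scale \<open>j0\<close> it is still \<open>b powr (j * (h' - h))\<close>
  times too large. But densities are at most 1.
\<close>

lemma path_bad_infinitely_often:
  assumes m: "\<bar>m\<bar> \<le> 1" and h: "h < h'" and bC: "12 * C \<le> real b powr h"
    and k: "\<And>j. k j \<in> P j" "\<And>j. k j = parent b (k (Suc j))"
    and rich: "\<exists>\<^sub>\<infinity>j. level j h' \<le> real (window_count m (P j) 5 (shear m (k j)))"
  shows "\<exists>\<^sub>\<infinity>j. k j \<in> bad h j m"
proof (rule ccontr)
  assume "\<not> (\<exists>\<^sub>\<infinity>j. k j \<in> bad h j m)"
  then obtain j0 where j0: "\<And>j. j \<ge> j0 \<Longrightarrow> k j \<notin> bad h j m"
    unfolding INFM_nat_le by auto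
  define G where "G j = real (window_count m (P j) 5 (shear m (k j))) / real (card (P j))" for j
  have step: "G j \<le> real b powr (h - 1) * G (j - 1)" if j: "j > j0" and big: "real b powr (real j * (h - 1)) \<le> G j" for j
  proof -
    obtain i where i: "j = Suc i" using j by (cases j) auto
    have "level j h \<le> real (window_count m (P j) 5 (shear m (k j)))"
      using big card_pos[of j] by (simp add: G_def level_def pos_le_divide_eq mult.commute)
    then have "G j \<le> 12 * C / real b * G i"
      using good_cell_step[OF fin[of j] m b6 _ k(1)[of j], of "level j h" C] j0[of j] j unif[of _ i]
      unfolding G_def i k(2)[of i] parents[of i] bad_def by simp
    also have "\<dots> \<le> real b powr (h - 1) * G i"
      using bC bR by (intro mult_right_mono) (auto simp: powr_diff G_def divide_right_mono)
    finally show ?thesis by (simp add: i)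
  qed
  have descend: "real b powr (real j * (h' - 1)) \<le> G j \<Longrightarrow> j \<ge> j0 \<Longrightarrow> i \<le> j - j0 \<Longrightarrow>
     real b powr (real j * (h' - h) + real (j - i) * (h - 1)) \<le> G (j - i)" for i j
  proof (induction i)
    case 0 then show ?case by (simp add: algebra_simps)
  next
    case (Suc i)
    define J where "J = j - i"
    have J: "J > j0" "j - Suc i = J - 1" using Suc by (auto simp: J_def)
    have IH: "real b powr (real j * (h' - h) + real J * (h - 1)) \<le> G J" using Suc by (simp add: J_def)
    have "real b powr (real J * (h - 1)) \<le> real b powr (real j * (h' - h) + real J * (h - 1))"
      using bR h by (intro powr_mono) auto
    with IH have "G J \<le> real b powr (h - 1) * G (J - 1)" by (intro step J) linarith
    with IH have "real b powr (real j * (h' - h) + real J * (h - 1)) \<le> real b powr (h - 1) * G (J - 1)" by linarith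
    moreover have "real b powr (real j * (h' - h) + real J * (h - 1))
        = real b powr (h - 1) * real b powr (real j * (h' - h) + real (J - 1) * (h - 1))"
      using J(1) by (simp add: powr_add[symmetric] of_nat_diff algebra_simps)
    ultimately show ?case using bR J(2) by simp
  qed
  have G1: "G j \<le> 1" for j
  proof -
    have "window_count m (P j) 5 (shear m (k j)) \<le> card (P j)"
      unfolding window_count_def by (intro card_mono fin) auto
    then show ?thesis using card_pos[of j] by (simp add: G_def)
  qed
  obtain J where J: "real J > real j0 * \<bar>h - 1\<bar> / (h' - h)" using reals_Archimedean2 by blast
  obtain j where j: "j \<ge> max J j0" "level j h' \<le> real (window_count m (P j) 5 (shear m (k j)))"
    using rich unfolding INFM_nat_le by blast
  have "real b powr (real j * (h' - 1)) \<le> G j"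
    using j(2) card_pos[of j] by (simp add: G_def level_def pos_le_divide_eq mult.commute)
  from descend[OF this, of "j - j0"] j(1)
  have "real b powr (real j * (h' - h) + real j0 * (h - 1)) \<le> 1" using G1[of j0] by auto
  moreover have "real j * (h' - h) + real j0 * (h - 1) > 0"
  proof -
    have "real j > real j0 * \<bar>h - 1\<bar> / (h' - h)" using J j(1) by linarith
    then have "real j * (h' - h) > real j0 * \<bar>h - 1\<bar>" using h by (simp add: field_simps)
    moreover have "real j0 * \<bar>h - 1\<bar> \<ge> - (real j0 * (h - 1))"
      by (metis abs_ge_minus_self abs_mult abs_of_nat)
    ultimately show ?thesis by linarith
  qed
  then have "real b powr (real j * (h' - h) + real j0 * (h - 1)) > 1"
    using bR by (intro gr_one_powr) auto
  ultimately show False by linarith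
qed

end

section \<open>Cells of points in the plane\<close>

text \<open>
  Lines are graphs of slope \<open>m\<close> over the coordinate \<open>i'\<close>. Both orders of the two
  coordinates are needed, as slopes are restricted to \<open>{-1..1}\<close>. The parameter \<open>q\<close> is the reciprocal
  of the side length.
\<close>

definition cell :: "2 \<Rightarrow> 2 \<Rightarrow> real \<Rightarrow> real^2 \<Rightarrow> int \<times> int" where
  "cell i i' q z = (\<lfloor>q * z $ i\<rfloor>, \<lfloor>q * z $ i'\<rfloor>)"

lemma UNIV_two: "i \<noteq> i' \<Longrightarrow> (UNIV :: 2 set) = {i, i'}"
  using exhaust_2[of i] exhaust_2[of i'] by (auto simp: UNIV_2)

lemma all_two: "i \<noteq> i' \<Longrightarrow> (\<forall>j::2. Q j) \<longleftrightarrow> Q i \<and> Q i'"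
proof -
  assume "i \<noteq> i'"
  have "(\<forall>j::2. Q j) \<longleftrightarrow> (\<forall>j\<in>UNIV. Q j)" by simp
  then show ?thesis by (simp add: UNIV_two[OF \<open>i \<noteq> i'\<close>])
qed

lemma dyadic_cubes_meeting_eq:
  assumes i: "i \<noteq> i'" and r: "r > 0"
  shows "dyadic_cubes_meeting r X = (\<lambda>c. {x. cell i i' (1 / r) x = c}) ` (cell i i' (1 / r) ` X)"
proof -
  have cube: "{x::real^2. \<forall>b\<in>Basis. r * of_int (k b) \<le> x \<bullet> b \<and> x \<bullet> b < r * (of_int (k b) + 1)}
     = {x. cell i i' (1 / r) x = (k (axis i 1), k (axis i' 1))}" (is "?L k = ?R k") for k
  proof -
    have "(\<forall>b\<in>Basis. r * of_int (k b) \<le> x \<bullet> b \<and> x \<bullet> b < r * (of_int (k b) + 1)) \<longleftrightarrow>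
       (\<forall>j. r * of_int (k (axis j 1)) \<le> x $ j \<and> x $ j < r * (of_int (k (axis j 1)) + 1))" for x :: "real^2"
      by (auto simp: Basis_vec_def inner_axis)
    also have "\<dots> x \<longleftrightarrow> (\<forall>j. \<lfloor>1 / r * x $ j\<rfloor> = k (axis j 1))" for x :: "real^2"
      using r by (auto simp: floor_eq_iff field_simps)
    finally show ?thesis by (simp add: cell_def all_two[OF i])
  qed
  show ?thesis
  proof (intro equalityI subsetI)
    fix Q assume "Q \<in> dyadic_cubes_meeting r X"
    then obtain k z where "Q = ?L k" "z \<in> Q" "z \<in> X"
      by (auto simp: dyadic_cubes_meeting_def dyadic_cubes_def)
    then show "Q \<in> (\<lambda>c. {x. cell i i' (1 / r) x = c}) ` (cell i i' (1 / r) ` X)"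
      unfolding cube by (intro image_eqI[where x="cell i i' (1/r) z"] imageI) auto
  next
    fix Q assume "Q \<in> (\<lambda>c. {x. cell i i' (1 / r) x = c}) ` (cell i i' (1 / r) ` X)"
    then obtain z where z: "z \<in> X" "Q = {x. cell i i' (1 / r) x = cell i i' (1 / r) z}" by auto
    define k where "k b = \<lfloor>1 / r * (z \<bullet> b)\<rfloor>" for b
    have "?L k = Q" unfolding cube z(2) by (simp add: cell_def k_def inner_axis)
    then have "Q \<in> dyadic_cubes r" unfolding dyadic_cubes_def by blast
    then show "Q \<in> dyadic_cubes_meeting r X" using z by (auto simp: dyadic_cubes_meeting_def)
  qed
qed

lemma dyadic_count_eq:
  assumes "i \<noteq> i'" "r > 0"
  shows "dyadic_count r X = card (cell i i' (1 / r) ` X)"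
  unfolding dyadic_count_def dyadic_cubes_meeting_eq[OF assms]
  by (rule card_image) (auto simp: inj_on_def)

lemma sub_uniformly_distributed_cells:
  assumes i: "i \<noteq> i'" and K: "sub_uniformly_distributed K"
  obtains C where "C > 0" "\<And>L j j' z. j \<le> j' \<Longrightarrow> z \<in> K \<Longrightarrow>
    real (card (cell i i' ((2 ^ L) ^ j) ` K)) *
      real (card (cell i i' ((2 ^ L) ^ j') ` {w\<in>K. cell i i' ((2 ^ L) ^ j) w = cell i i' ((2 ^ L) ^ j) z}))
    \<le> C * real (card (cell i i' ((2 ^ L) ^ j') ` K))"
proof -
  obtain C where C: "C > 0" "\<And>r R Q. r \<in> dyadic_numbers \<Longrightarrow> R \<in> dyadic_numbers \<Longrightarrow> r \<le> R \<Longrightarrow>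
      Q \<in> dyadic_cubes_meeting R K \<Longrightarrow>
      real (dyadic_count R K) * real (dyadic_count r (K \<inter> Q)) \<le> C * real (dyadic_count r K)"
    using K unfolding sub_uniformly_distributed_def by metis
  show ?thesis
  proof (rule that[OF C(1)])
    fix L j j' :: nat and z assume jj: "j \<le> j'" and z: "z \<in> K"
    define r :: "nat \<Rightarrow> real" where "r j = 1 / (2 ^ L) ^ j" for j
    have r0: "r j > 0" for j by (simp add: r_def)
    have rq: "1 / r j = (2 ^ L) ^ j" for j by (simp add: r_def)
    have rd: "r j \<in> dyadic_numbers" for j
      unfolding dyadic_numbers_def r_def
      by (rule range_eqI[where x="- int (L * j)"]) (simp only: power_int_minus power_int_of_nat power_mult inverse_eq_divide)
    have le: "r j' \<le> r j" unfolding r_def using jj by (intro divide_left_mono power_increasing) auto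
    have Q: "{w. cell i i' (1 / r j) w = cell i i' (1 / r j) z} \<in> dyadic_cubes_meeting (r j) K"
      unfolding dyadic_cubes_meeting_eq[OF i r0] using z by blast
    have "K \<inter> {w. cell i i' (1 / r j) w = cell i i' (1 / r j) z} = {w\<in>K. cell i i' (1 / r j) w = cell i i' (1 / r j) z}"
      by auto
    with C(2)[OF rd rd le Q] show "real (card (cell i i' ((2 ^ L) ^ j) ` K)) *
      real (card (cell i i' ((2 ^ L) ^ j') ` {w\<in>K. cell i i' ((2 ^ L) ^ j) w = cell i i' ((2 ^ L) ^ j) z}))
    \<le> C * real (card (cell i i' ((2 ^ L) ^ j') ` K))"
      unfolding dyadic_count_eq[OF i r0] rq by simp
  qed
qed

lemma finite_cells:
  assumes "bounded K" shows "finite (cell i i' q ` K)"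
proof -
  obtain D where D: "\<And>x. x \<in> K \<Longrightarrow> norm x \<le> D" using assms bounded_iff by metis
  have *: "\<lfloor>q * x $ j\<rfloor> \<in> {\<lfloor>- (\<bar>q\<bar> * D)\<rfloor>..\<lfloor>\<bar>q\<bar> * D\<rfloor>}" if "x \<in> K" for x j
  proof -
    have "\<bar>x $ j\<bar> \<le> D" using component_le_norm_cart[of x j] D[OF that] by linarith
    then have "\<bar>q * x $ j\<bar> \<le> \<bar>q\<bar> * D" by (simp add: abs_mult mult_left_mono)
    then have "- (\<bar>q\<bar> * D) \<le> q * x $ j" "q * x $ j \<le> \<bar>q\<bar> * D" by linarith+
    then show ?thesis by (simp add: floor_mono)
  qed
  have "cell i i' q ` K \<subseteq> {\<lfloor>- (\<bar>q\<bar> * D)\<rfloor>..\<lfloor>\<bar>q\<bar> * D\<rfloor>} \<times> {\<lfloor>- (\<bar>q\<bar> * D)\<rfloor>..\<lfloor>\<bar>q\<bar> * D\<rfloor>}"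
    using * by (auto simp: cell_def simp del: atLeastAtMost_iff)
  then show ?thesis by (rule finite_subset) auto
qed

lemma dist_same_cell:
  assumes i: "i \<noteq> i'" and q: "q > 0" and c: "cell i i' q x = cell i i' q y"
  shows "norm (x - y) \<le> 2 / q"
proof -
  have *: "\<bar>(x - y) $ j\<bar> \<le> 1 / q" if "\<lfloor>q * x $ j\<rfloor> = \<lfloor>q * y $ j\<rfloor>" for j
  proof -
    have "\<bar>q * x $ j - q * y $ j\<bar> \<le> 1" using that by linarith
    then have "q * \<bar>(x - y) $ j\<bar> \<le> 1" using q by (simp add: right_diff_distrib[symmetric] abs_mult)
    then show ?thesis using q by (simp add: field_simps)
  qed
  have "norm (x - y) \<le> (\<Sum>j\<in>UNIV. \<bar>(x - y) $ j\<bar>)" by (rule norm_le_l1_cart)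
  also have "\<dots> = \<bar>(x - y) $ i\<bar> + \<bar>(x - y) $ i'\<bar>" unfolding UNIV_two[OF i] using i by simp
  also have "\<dots> \<le> 1 / q + 1 / q" by (intro add_mono *) (use c in \<open>auto simp: cell_def\<close>)
  finally show ?thesis by simp
qed

lemma bounded_cell: assumes "i \<noteq> i'" "q > 0" shows "bounded {x. cell i i' q x = c}"
proof (cases "\<exists>y. cell i i' q y = c")
  case True
  then obtain y where y: "cell i i' q y = c" by blast
  have "{x. cell i i' q x = c} \<subseteq> cball y (2 / q)"
    using dist_same_cell[OF assms] y by (auto simp: dist_norm norm_minus_commute)
  then show ?thesis by (rule bounded_subset[OF bounded_cball])
next
  case False
  then have "{x. cell i i' q x = c} = {}" by blast
  then show ?thesis by (simp only: bounded_empty)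
qed

lemma diameter_cell: assumes "i \<noteq> i'" "q > 0" shows "diameter {x. cell i i' q x = c} \<le> 2 / q"
  by (rule diameter_le) (use assms dist_same_cell in auto)

lemma covering_number_le_cells:
  assumes "i \<noteq> i'" "q > 0" "bounded E" "2 / q \<le> \<delta>"
  shows "covering_number E \<delta> \<le> card (cell i i' q ` E)"
proof -
  define \<C> where "\<C> = (\<lambda>c. {x. cell i i' q x = c}) ` (cell i i' q ` E)"
  have 1: "finite \<C>" unfolding \<C>_def by (intro finite_imageI finite_cells assms)
  have 2: "E \<subseteq> \<Union>\<C>" unfolding \<C>_def by blast
  have 3: "\<forall>U\<in>\<C>. bounded U \<and> diameter U \<le> \<delta>"
  proof
    fix U assume "U \<in> \<C>"
    then obtain c where "U = {x. cell i i' q x = c}" unfolding \<C>_def by blast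
    then show "bounded U \<and> diameter U \<le> \<delta>"
      using bounded_cell[OF assms(1,2)] order_trans[OF diameter_cell[OF assms(1,2)] assms(4)] by blast
  qed
  have "covering_number E \<delta> \<le> card \<C>"
    unfolding covering_number_def by (rule cInf_lower) (use 1 2 3 in blast, simp)
  also have "\<dots> \<le> card (cell i i' q ` E)" unfolding \<C>_def by (intro card_image_le finite_cells assms)
  finally show ?thesis .
qed

section \<open>Cells of line slices\<close>

text \<open>
  Passing from an arbitrary scale \<open>\<delta>\<close> to the nearest power of \<open>b\<close> costs a bounded factor, which a
  smaller exponent absorbs at small scales.
\<close>

lemma cells_ge_of_covering_ratio:
  assumes i: "i \<noteq> i'" and b: "(b::real) \<ge> 2" and E: "bounded E" and s: "0 \<le> s" "s < s'"
  shows "\<exists>J. \<forall>j\<ge>J. \<forall>\<delta>. 0 < \<delta> \<longrightarrow> \<delta> < 1 \<longrightarrow> 2 / b ^ j \<le> \<delta> \<longrightarrow> \<delta> \<le> 2 * b / b ^ j \<longrightarrow>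
    s' < ln (real (covering_number E \<delta>)) / ln (1 / \<delta>) \<longrightarrow> b powr (real j * s) \<le> real (card (cell i i' (b ^ j) ` E))"
proof -
  obtain J :: nat where J: "real J \<ge> s' * ln (2 * b) / ((s' - s) * ln b)" using real_arch_simple by blast
  show ?thesis
  proof (intro exI[of _ J] allI impI)
    fix j \<delta> assume j: "j \<ge> J" and d: "0 < \<delta>" "\<delta> < 1" "2 / b ^ j \<le> \<delta>" "\<delta> \<le> 2 * b / b ^ j"
      and r: "s' < ln (real (covering_number E \<delta>)) / ln (1 / \<delta>)"
    define n where "n = covering_number E \<delta>"
    have lb: "ln b > 0" using b by simp
    have l: "ln (1 / \<delta>) > 0" using d by simp
    have "s' * ln (1 / \<delta>) < ln (real n)" using r l by (simp add: n_def field_simps)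
    moreover have "s' * ln (1 / \<delta>) \<ge> 0" using s l by simp
    ultimately have n: "ln (real n) > 0" "s' * ln (1 / \<delta>) < ln (real n)" by linarith+
    then have n0: "n > 0" by (cases n) auto
    have "b ^ j / (2 * b) \<le> 1 / \<delta>" using d b by (simp add: field_simps)
    then have "ln (b ^ j / (2 * b)) \<le> ln (1 / \<delta>)" using b d by (intro ln_mono) auto
    moreover have "ln (b ^ j / (2 * b)) = real j * ln b - ln (2 * b)"
      using b by (simp add: ln_div ln_realpow)
    ultimately have "s' * (real j * ln b - ln (2 * b)) \<le> s' * ln (1 / \<delta>)" using s by (intro mult_left_mono) auto
    moreover have "s' * ln (2 * b) \<le> real j * ((s' - s) * ln b)"
    proof -
      have "s' * ln (2 * b) / ((s' - s) * ln b) \<le> real j" using J j by linarith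
      then show ?thesis using s lb by (simp add: pos_divide_le_eq)
    qed
    ultimately have "real j * s * ln b \<le> ln (real n)" using n(2) by (simp add: algebra_simps)
    then have "exp (real j * s * ln b) \<le> exp (ln (real n))" by simp
    then have "b powr (real j * s) \<le> real n" using n0 b by (simp add: powr_def)
    also have "n \<le> card (cell i i' (b ^ j) ` E)"
      unfolding n_def by (rule covering_number_le_cells) (use i b E d in auto)
    finally show "b powr (real j * s) \<le> real (card (cell i i' (b ^ j) ` E))" by simp
  qed
qed

lemma lower_box_dim_cells:
  assumes i: "i \<noteq> i'" and b: "(b::real) \<ge> 2" and E: "bounded E" and s: "0 \<le> s" "s < s'"
    and dim: "lower_box_dim E \<ge> ereal s'"
  shows "eventually (\<lambda>j. b powr (real j * s) \<le> real (card (cell i i' (b ^ j) ` E))) sequentially"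
proof -
  obtain s1 where s1: "s < s1" "s1 < s'" using s dense by blast
  obtain J where J: "\<And>j \<delta>. j \<ge> J \<Longrightarrow> 0 < \<delta> \<Longrightarrow> \<delta> < 1 \<Longrightarrow> 2 / b ^ j \<le> \<delta> \<Longrightarrow> \<delta> \<le> 2 * b / b ^ j \<Longrightarrow>
    s1 < ln (real (covering_number E \<delta>)) / ln (1 / \<delta>) \<Longrightarrow> b powr (real j * s) \<le> real (card (cell i i' (b ^ j) ` E))"
    using cells_ge_of_covering_ratio[OF i b E s(1) s1(1)] by blast
  have "eventually (\<lambda>\<delta>. ereal s1 < ereal (ln (real (covering_number E \<delta>)) / ln (1 / \<delta>))) (at_right 0)"
  proof (rule less_LiminfD)
    have "ereal s1 < ereal s'" using s1 by simp
    also have "\<dots> \<le> lower_box_dim E" by fact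
    finally show "ereal s1 < Liminf (at_right 0) (\<lambda>\<delta>. ereal (ln (real (covering_number E \<delta>)) / ln (1 / \<delta>)))"
      by (simp add: lower_box_dim_def)
  qed
  moreover have "eventually (\<lambda>\<delta>::real. \<delta> < 1) (at_right 0)"
    unfolding eventually_at_right_field by (rule exI[of _ 1]) simp
  ultimately have ev: "eventually (\<lambda>\<delta>. s1 < ln (real (covering_number E \<delta>)) / ln (1 / \<delta>) \<and> \<delta> < 1) (at_right 0)"
    by eventually_elim simp
  have lim: "filterlim (\<lambda>j. 2 / b ^ j) (at_right 0) sequentially"
    unfolding filterlim_at
  proof
    have "(\<lambda>j. 2 * (1 / b) ^ j) \<longlonglongrightarrow> 2 * 0" using b by (intro tendsto_intros LIMSEQ_realpow_zero) auto
    then show "(\<lambda>j. 2 / b ^ j) \<longlonglongrightarrow> 0" by (simp add: power_one_over)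
  qed (use b in auto)
  have "eventually (\<lambda>j. s1 < ln (real (covering_number E (2 / b ^ j))) / ln (1 / (2 / b ^ j)) \<and> 2 / b ^ j < 1) sequentially"
    using filterlim_iff[THEN iffD1, OF lim, rule_format, OF ev] .
  then show ?thesis
    using eventually_ge_at_top[of J]
  proof eventually_elim
    case (elim j)
    have "2 / b ^ j \<le> 2 * b / b ^ j" using b by (intro divide_right_mono) auto
    then show ?case using elim J[of j "2 / b ^ j"] b by simp
  qed
qed

lemma upper_box_dim_cells:
  assumes i: "i \<noteq> i'" and b: "(b::real) \<ge> 2" and E: "bounded E" and s: "0 \<le> s" "s < s'"
    and dim: "upper_box_dim E \<ge> ereal s'"
  shows "\<exists>\<^sub>\<infinity>j. b powr (real j * s) \<le> real (card (cell i i' (b ^ j) ` E))"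
  unfolding INFM_nat_le
proof
  fix m
  obtain s1 where s1: "s < s1" "s1 < s'" using s dense by blast
  obtain J where J: "\<And>j \<delta>. j \<ge> J \<Longrightarrow> 0 < \<delta> \<Longrightarrow> \<delta> < 1 \<Longrightarrow> 2 / b ^ j \<le> \<delta> \<Longrightarrow> \<delta> \<le> 2 * b / b ^ j \<Longrightarrow>
    s1 < ln (real (covering_number E \<delta>)) / ln (1 / \<delta>) \<Longrightarrow> b powr (real j * s) \<le> real (card (cell i i' (b ^ j) ` E))"
    using cells_ge_of_covering_ratio[OF i b E s(1) s1(1)] by blast
  have freq: "frequently (\<lambda>\<delta>. ereal s1 < ereal (ln (real (covering_number E \<delta>)) / ln (1 / \<delta>))) (at_right 0)"
  proof (rule ccontr)
    assume "\<not> ?thesis"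
    then have "eventually (\<lambda>\<delta>. ereal (ln (real (covering_number E \<delta>)) / ln (1 / \<delta>)) \<le> ereal s1) (at_right 0)"
      by (simp add: not_frequently not_less)
    then have "upper_box_dim E \<le> ereal s1" unfolding upper_box_dim_def by (rule Limsup_bounded)
    then show False using dim s1 by (metis ereal_less_le less_ereal.simps(1) not_less order_trans)
  qed
  define M where "M = max m J"
  have bM: "b ^ M > 0" using b by simp
  have "eventually (\<lambda>\<delta>::real. 0 < \<delta> \<and> \<delta> < 1 \<and> \<delta> < 2 / b ^ M) (at_right 0)"
    unfolding eventually_at_right_field using bM by (intro exI[of _ "min 1 (2 / b ^ M)"]) auto
  from frequently_eventually_conj[OF freq this]
  obtain \<delta> where d: "s1 < ln (real (covering_number E \<delta>)) / ln (1 / \<delta>)" "0 < \<delta>" "\<delta> < 1" "\<delta> < 2 / b ^ M"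
    using frequently_ex by fastforce
  have "\<exists>j. 2 / b ^ j \<le> \<delta>"
  proof -
    obtain j where "2 / \<delta> < b ^ j" using real_arch_pow[of b "2 / \<delta>"] b by auto
    then have "2 / b ^ j \<le> \<delta>" using d b by (simp add: field_simps)
    then show ?thesis ..
  qed
  define j where "j = (LEAST j. 2 / b ^ j \<le> \<delta>)"
  have j: "2 / b ^ j \<le> \<delta>" unfolding j_def by (rule LeastI_ex) fact
  have "j > M"
  proof (rule ccontr)
    assume "\<not> j > M"
    then have "2 / b ^ M \<le> 2 / b ^ j" using b by (intro divide_left_mono power_increasing) auto
    then show False using j d by linarith
  qed
  then obtain l where l: "j = Suc l" by (cases j) auto
  have "\<not> 2 / b ^ l \<le> \<delta>" using not_less_Least[of l "\<lambda>j. 2 / b ^ j \<le> \<delta>"] l by (simp add: j_def)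
  then have "\<delta> \<le> 2 * b / b ^ j" using b l by simp
  then have "b powr (real j * s) \<le> real (card (cell i i' (b ^ j) ` E))"
    using J[of j \<delta>] j d \<open>j > M\<close> by (simp add: M_def)
  then show "\<exists>j\<ge>m. b powr (real j * s) \<le> real (card (cell i i' (b ^ j) ` E))"
    using \<open>j > M\<close> by (auto simp: M_def intro!: exI[of _ j])
qed

text \<open>
  Rounding subtracts a fractional part from each coordinate. Two fractional parts differ by at most 1, so
  the cells of two points on the same line have shears at distance at most 2, within the window 5.
\<close>

lemma slice_cells_le_window:
  assumes m: "\<bar>m\<bar> \<le> 1" and q: "q > 0" and K: "bounded K"
  shows "card (cell i i' q ` {w\<in>K. w $ i - m * w $ i' = z $ i - m * z $ i'})
    \<le> window_count m (cell i i' q ` K) 5 (shear m (cell i i' q z))"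
  unfolding window_count_def
proof (rule card_mono)
  show "finite {l \<in> cell i i' q ` K. \<bar>shear m l - shear m (cell i i' q z)\<bar> \<le> 5}" 
    by (rule finite_subset[OF _ finite_cells[OF K, of i i' q]]) blast
  show "cell i i' q ` {w\<in>K. w $ i - m * w $ i' = z $ i - m * z $ i'}
    \<subseteq> {l \<in> cell i i' q ` K. \<bar>shear m l - shear m (cell i i' q z)\<bar> \<le> 5}"
  proof (rule image_subsetI)
    fix w assume "w \<in> {w\<in>K. w $ i - m * w $ i' = z $ i - m * z $ i'}"
    then have w: "w \<in> K" "w $ i - m * w $ i' = z $ i - m * z $ i'" by blast+
    define f where "f x j = q * x $ j - \<lfloor>q * x $ j\<rfloor>" for x :: "real^2" and j
    have f: "0 \<le> f x j" "f x j \<le> 1" for x j unfolding f_def by linarith+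
    have sh: "shear m (cell i i' q x) = q * (x $ i - m * x $ i') - f x i + m * f x i'" for x
      by (simp add: shear_def cell_def f_def algebra_simps)
    have "\<bar>m\<bar> * \<bar>f w i' - f z i'\<bar> \<le> 1 * 1" using m f[of w i'] f[of z i'] by (intro mult_mono) auto
    then have "\<bar>m * f w i' - m * f z i'\<bar> \<le> 1" by (simp add: abs_mult[symmetric] right_diff_distrib)
    then have "\<bar>shear m (cell i i' q w) - shear m (cell i i' q z)\<bar> \<le> 5"
      unfolding sh w(2) using f[of w i] f[of z i] by linarith
    then show "cell i i' q w \<in> {l \<in> cell i i' q ` K. \<bar>shear m l - shear m (cell i i' q z)\<bar> \<le> 5}"
      using w by auto
  qed
qed

lemma parent_cell:
  assumes "b \<ge> 1" shows "parent b (cell i i' (real b ^ Suc j) z) = cell i i' (real b ^ j) z"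
proof -
  have "\<lfloor>real b ^ Suc j * x\<rfloor> div int b = \<lfloor>real b ^ j * x\<rfloor>" for x
  proof -
    have "real b ^ Suc j * x / real_of_int (int b) = real b ^ j * x" using assms by simp
    then show ?thesis using floor_divide_real_eq_div[of "int b" "real b ^ Suc j * x"] by simp
  qed
  then show ?thesis unfolding parent_def cell_def fst_conv snd_conv by blast
qed

lemma cell_spread:
  assumes "\<And>x. x \<in> K \<Longrightarrow> norm x \<le> D0" "2 * D0 + 1 \<le> real D" "b \<ge> 1"
    "k \<in> cell i i' (real b ^ j) ` K" "l \<in> cell i i' (real b ^ j) ` K"
  shows "\<bar>snd k - snd l\<bar> \<le> int (D * b ^ j)"
proof -
  obtain x y where xy: "x \<in> K" "y \<in> K" "snd k = \<lfloor>real b ^ j * x $ i'\<rfloor>" "snd l = \<lfloor>real b ^ j * y $ i'\<rfloor>"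
    using assms(4,5) by (auto simp: cell_def)
  define q where "q = real b ^ j"
  have q: "q \<ge> 1" using assms(3) by (simp add: q_def)
  have "\<bar>x $ i' - y $ i'\<bar> \<le> 2 * D0"
    using component_le_norm_cart[of x i'] component_le_norm_cart[of y i'] assms(1)[OF xy(1)] assms(1)[OF xy(2)] by linarith
  then have "q * \<bar>x $ i' - y $ i'\<bar> \<le> q * (2 * D0)" using q by (intro mult_left_mono) auto
  then have "\<bar>q * x $ i' - q * y $ i'\<bar> \<le> q * (2 * D0)" using q by (simp add: right_diff_distrib[symmetric] abs_mult)
  then have "\<bar>real_of_int (snd k) - real_of_int (snd l)\<bar> \<le> q * (2 * D0) + 1"
    unfolding xy q_def[symmetric] by linarith
  also have "\<dots> \<le> q * (2 * D0 + 1)" using q by (simp add: algebra_simps)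
  also have "\<dots> \<le> q * real D" using q assms(2) by (intro mult_left_mono) auto
  finally have "real_of_int \<bar>snd k - snd l\<bar> \<le> real_of_int (int (D * b ^ j))" by (simp add: q_def mult.commute)
  then show ?thesis by (simp only: of_int_le_iff)
qed

section \<open>Scales with few cells\<close>

text \<open>
  The radii are chosen so that \<open>\<rho> powr u\<close> exceeds the power of the diameter by a summable error;
  this also covers sets of diameter 0.
\<close>

lemma hausdorff_null_ball_cover:
  fixes E :: "'a::metric_space set"
  assumes u: "u > 0" and null: "hausdorff_measure u E = 0" and e: "\<epsilon> > 0"
  obtains x :: "nat \<Rightarrow> 'a" and \<rho> where "E \<subseteq> (\<Union>n. ball (x n) (\<rho> n))" "\<And>n. \<rho> n > 0"
    "\<And>F. finite F \<Longrightarrow> (\<Sum>n\<in>F. \<rho> n powr u) \<le> \<epsilon>"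
proof -
  have "hausdorff_premeasure u 1 E = 0" using null by (simp add: hausdorff_measure_eq_0_iff)
  then have "hausdorff_premeasure u 1 E < ennreal (\<epsilon> / 2)" using e by simp
  then obtain U where U: "E \<subseteq> (\<Union>n::nat. U n)" "\<And>n. bounded (U n)" "(\<Sum>n. diam_power u (U n)) < ennreal (\<epsilon> / 2)"
    unfolding hausdorff_premeasure_def by (auto simp: INF_less_iff)
  define d where "d n = diameter (U n) powr u" for n
  define e' where "e' n = \<epsilon> / 2 * (1/2) ^ Suc n" for n
  define \<rho> where "\<rho> n = (d n + e' n) powr (1 / u)" for n
  define x where "x n = (SOME y. y \<in> U n)" for n
  have d0: "d n \<ge> 0" and e0: "e' n > 0" for n using e by (auto simp: d_def e'_def)
  have dp: "diam_power u (U n) = ennreal (d n)" for n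
    using u by (auto simp: diam_power_def d_def diameter_def)
  have \<rho>u: "\<rho> n powr u = d n + e' n" for n
    using d0[of n] e0[of n] u by (simp add: \<rho>_def powr_powr)
  have \<rho>d: "diameter (U n) < \<rho> n" for n
  proof (rule ccontr)
    assume "\<not> diameter (U n) < \<rho> n"
    then have "\<rho> n powr u \<le> d n" unfolding d_def using u by (intro powr_mono2) (auto simp: \<rho>_def)
    then show False using e0[of n] by (simp add: \<rho>u)
  qed
  have UB: "U n \<subseteq> ball (x n) (\<rho> n)" for n
  proof
    fix y assume y: "y \<in> U n"
    then have "x n \<in> U n" unfolding x_def by (rule someI)
    then have "dist (x n) y \<le> diameter (U n)" using y U(2) by (intro diameter_bounded_bound)
    then show "y \<in> ball (x n) (\<rho> n)" using \<rho>d[of n] by simp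
  qed
  show ?thesis
  proof (rule that)
    show "E \<subseteq> (\<Union>n. ball (x n) (\<rho> n))" using U(1) UB by blast
    show "\<rho> n > 0" for n using d0[of n] e0[of n] by (auto simp: \<rho>_def)
    fix F :: "nat set" assume F: "finite F"
    have "ennreal (\<Sum>n\<in>F. d n) = (\<Sum>n\<in>F. diam_power u (U n))" by (simp add: dp d0 sum_ennreal)
    also have "\<dots> \<le> (\<Sum>n. diam_power u (U n))" by (rule sum_le_suminf) (use F in auto)
    also have "\<dots> \<le> ennreal (\<epsilon> / 2)" using U(3) by simp
    finally have 1: "(\<Sum>n\<in>F. d n) \<le> \<epsilon> / 2" using e by simp
    have "(\<Sum>n\<in>F. (1/2::real) ^ Suc n) \<le> (\<Sum>n. (1/2) ^ Suc n)"
      by (rule sum_le_suminf) (use F sums_summable[OF power_half_series] in auto)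
    then have "(\<Sum>n\<in>F. (1/2::real) ^ Suc n) \<le> 1" using sums_unique[OF power_half_series] by simp
    then have "(\<Sum>n\<in>F. e' n) \<le> \<epsilon> / 2 * 1"
      unfolding e'_def sum_distrib_left[symmetric] using e by (intro mult_left_mono) auto
    with 1 show "(\<Sum>n\<in>F. \<rho> n powr u) \<le> \<epsilon>" by (simp add: \<rho>u sum.distrib)
  qed
qed

lemma card_cells_ball_le:
  assumes q: "q > 0" "q * \<rho> \<le> 1"
  shows "card (cell i i' q ` (K \<inter> ball x \<rho>)) \<le> 9" "finite (cell i i' q ` (K \<inter> ball x \<rho>))"
proof -
  define I where "I j = {\<lfloor>q * x $ j\<rfloor> - 1..\<lfloor>q * x $ j\<rfloor> + 1}" for j
  have "\<lfloor>q * z $ j\<rfloor> \<in> I j" if "z \<in> ball x \<rho>" for z j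
  proof -
    have "\<bar>(z - x) $ j\<bar> \<le> \<rho>" using component_le_norm_cart[of "z - x" j] that by (simp add: dist_norm norm_minus_commute)
    then have "q * \<bar>(z - x) $ j\<bar> \<le> 1" using q mult_left_mono[of "\<bar>(z - x) $ j\<bar>" \<rho> q] by linarith
    then have "\<bar>q * z $ j - q * x $ j\<bar> \<le> 1" using q(1) by (simp add: abs_mult right_diff_distrib[symmetric])
    then show ?thesis unfolding I_def atLeastAtMost_iff by linarith
  qed
  then have sub: "cell i i' q ` (K \<inter> ball x \<rho>) \<subseteq> I i \<times> I i'" by (auto simp: cell_def)
  have fin: "finite (I i \<times> I i')" by (simp add: I_def)
  have "card (cell i i' q ` (K \<inter> ball x \<rho>)) \<le> card (I i \<times> I i')" by (rule card_mono[OF fin sub])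
  also have "\<dots> = 9" by (simp add: I_def)
  finally show "card (cell i i' q ` (K \<inter> ball x \<rho>)) \<le> 9" .
  show "finite (cell i i' q ` (K \<inter> ball x \<rho>))" using sub fin by (rule finite_subset)
qed

text \<open>
  A mass distribution argument with counts in place of a measure. Suppose that \<open>N j > b powr (j * u)\<close> at all
  scales from \<open>j0\<close> on. Cover \<open>K\<close> by finitely many balls, of total \<open>u\<close>-size \<open>\<epsilon>\<close>, and count cells at a
  scale \<open>J\<close> finer than all of them. By sub-uniformity a ball of radius about \<open>b ^ (- j)\<close> contains at most \<open>9 * C / N j\<close> times
  the total number of cells, which is of the order of its \<open>u\<close>-size. For small \<open>\<epsilon>\<close> the balls cannot contain all
  cells.
\<close>

lemma few_cells_infinitely_often:
  fixes K :: "(real^2) set" and b :: real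
  assumes b: "b \<ge> 2" and K: "compact K" "K \<noteq> {}" and C: "C > 0"
    and unif: "\<And>j j' z. j \<le> j' \<Longrightarrow> z \<in> K \<Longrightarrow>
      real (card (cell i i' (b ^ j) ` K)) * real (card (cell i i' (b ^ j') ` {w\<in>K. cell i i' (b ^ j) w = cell i i' (b ^ j) z}))
       \<le> C * real (card (cell i i' (b ^ j') ` K))"
    and u: "u > 0" and null: "hausdorff_measure u K = 0"
  shows "\<exists>\<^sub>\<infinity>j. real (card (cell i i' (b ^ j) ` K)) \<le> b powr (real j * u)"
proof (rule ccontr)
  define N where "N j = real (card (cell i i' (b ^ j) ` K))" for j
  have fin: "finite (cell i i' q ` K)" for q using K by (intro finite_cells compact_imp_bounded)
  have N0: "N j > 0" for j using K fin by (simp add: N_def card_gt_0_iff)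
  assume "\<not> ?thesis"
  then obtain j0 where j0: "\<And>j. j \<ge> j0 \<Longrightarrow> N j > b powr (real j * u)"
    unfolding INFM_nat_le N_def by (meson not_le)
  \<comment> \<open>The first bound makes the total count at most half of what it should be; the second one forces
    all radii below the scale \<open>j0\<close>.\<close>
  define \<epsilon> where "\<epsilon> = min (1 / (18 * C * b powr u)) (b powr (- real j0 * u))"
  have e: "\<epsilon> > 0" using C b by (simp add: \<epsilon>_def)
  obtain x \<rho> where cov: "K \<subseteq> (\<Union>n::nat. ball (x n) (\<rho> n))" and \<rho>0: "\<And>n. \<rho> n > 0"
    and \<rho>s: "\<And>F. finite F \<Longrightarrow> (\<Sum>n\<in>F. \<rho> n powr u) \<le> \<epsilon>"
    using hausdorff_null_ball_cover[OF u null e] by metis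
  obtain F where F: "finite F" "K \<subseteq> (\<Union>n\<in>F. ball (x n) (\<rho> n))"
    using compactE_image[OF K(1), of UNIV "\<lambda>n. ball (x n) (\<rho> n)"] cov by auto
  have scale: "\<exists>j\<ge>j0. b ^ j * \<rho> n \<le> 1 \<and> 1 < b ^ Suc j * \<rho> n" for n
  proof -
    have "\<rho> n powr u \<le> \<epsilon>" using \<rho>s[of "{n}"] by simp
    also have "\<dots> \<le> b powr (- real j0 * u)" by (simp add: \<epsilon>_def)
    also have "\<dots> = (b powr (- real j0)) powr u" by (simp add: powr_powr)
    finally have "\<rho> n \<le> b powr (- real j0)" using u powr_less_mono2[OF u, of "b powr (- real j0)" "\<rho> n"] by (auto simp: not_less[symmetric])
    also have "\<dots> = 1 / b ^ j0" using b by (simp add: powr_minus powr_realpow inverse_eq_divide)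
    finally have j0': "b ^ j0 * \<rho> n \<le> 1" using b by (simp add: field_simps)
    obtain k where k: "1 / \<rho> n < b ^ k" using real_arch_pow[of b "1 / \<rho> n"] b by auto
    define l where "l = (LEAST k. 1 < b ^ k * \<rho> n)"
    have l: "1 < b ^ l * \<rho> n" unfolding l_def
      by (rule LeastI[of _ k]) (use k \<rho>0[of n] in \<open>simp add: field_simps\<close>)
    have "l > j0"
    proof (rule ccontr)
      assume "\<not> l > j0"
      then have "b ^ l * \<rho> n \<le> b ^ j0 * \<rho> n" using b \<rho>0[of n] by (intro mult_right_mono power_increasing) auto
      then show False using l j0' by linarith
    qed
    then obtain j where j: "l = Suc j" by (cases l) auto
    have "\<not> 1 < b ^ j * \<rho> n" using not_less_Least[of j "\<lambda>k. 1 < b ^ k * \<rho> n"] j by (simp add: l_def)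
    then show ?thesis using l j \<open>l > j0\<close> by (intro exI[of _ j]) auto
  qed
  then obtain s where s: "\<And>n. s n \<ge> j0" "\<And>n. b ^ s n * \<rho> n \<le> 1" "\<And>n. 1 < b ^ Suc (s n) * \<rho> n" by metis
  obtain J where J: "\<And>n. n \<in> F \<Longrightarrow> s n \<le> J" using F(1) by (metis Max_ge finite_imageI imageI)
  have piece: "real (card (cell i i' (b ^ J) ` (K \<inter> ball (x n) (\<rho> n)))) \<le> 9 * C * b powr u * N J * \<rho> n powr u" if n: "n \<in> F" for n
  proof -
    define X where "X = K \<inter> ball (x n) (\<rho> n)"
    define Y where "Y = cell i i' (b ^ s n) ` X"
    have Y: "card Y \<le> 9" "finite Y" unfolding Y_def X_def using card_cells_ball_le[of "b ^ s n" "\<rho> n"] s b by auto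
    define V where "V c = {w\<in>K. cell i i' (b ^ s n) w = c}" for c
    have "cell i i' (b ^ J) ` X \<subseteq> (\<Union>c\<in>Y. cell i i' (b ^ J) ` V c)" by (auto simp: Y_def X_def V_def)
    then have "card (cell i i' (b ^ J) ` X) \<le> card (\<Union>c\<in>Y. cell i i' (b ^ J) ` V c)"
      using Y by (intro card_mono finite_UN_I finite_subset[OF _ fin]) (auto simp: V_def)
    also have "\<dots> \<le> (\<Sum>c\<in>Y. card (cell i i' (b ^ J) ` V c))" by (rule card_UN_le[OF Y(2)])
    finally have "real (card (cell i i' (b ^ J) ` X)) \<le> (\<Sum>c\<in>Y. real (card (cell i i' (b ^ J) ` V c)))"
      by (simp only: of_nat_le_iff of_nat_sum[symmetric])
    also have "\<dots> \<le> (\<Sum>c\<in>Y. C * N J / N (s n))"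
    proof (rule sum_mono)
      fix c assume "c \<in> Y"
      then obtain z where z: "z \<in> K" "c = cell i i' (b ^ s n) z" by (auto simp: Y_def X_def)
      show "real (card (cell i i' (b ^ J) ` V c)) \<le> C * N J / N (s n)"
        using unif[OF J[OF n] z(1)] N0[of "s n"] unfolding V_def z(2) N_def[symmetric]
        by (simp add: pos_le_divide_eq mult.commute)
    qed
    also have "\<dots> = real (card Y) * (C * N J / N (s n))" by simp
    also have "\<dots> \<le> 9 * (C * N J / N (s n))" using Y(1) C N0 by (intro mult_right_mono) (auto simp: less_imp_le)
    also have "\<dots> \<le> 9 * (C * N J * (b powr u * \<rho> n powr u))"
    proof -
      have "1 \<le> (b ^ Suc (s n) * \<rho> n) powr u" using s(3)[of n] u by (intro ge_one_powr_ge_zero) auto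
      also have "\<dots> = b powr u * \<rho> n powr u * b powr (real (s n) * u)"
        using b \<rho>0[of n] by (simp add: powr_mult powr_realpow[symmetric] powr_powr mult_ac)
      also have "\<dots> \<le> b powr u * \<rho> n powr u * N (s n)"
        using j0[OF s(1)[of n]] by (intro mult_left_mono) auto
      finally have "1 / N (s n) \<le> b powr u * \<rho> n powr u" using N0[of "s n"] by (simp add: pos_divide_le_eq)
      then have "C * N J * (1 / N (s n)) \<le> C * N J * (b powr u * \<rho> n powr u)"
        using C N0[of J] by (intro mult_left_mono) auto
      then show ?thesis by simp
    qed
    finally show ?thesis by (simp add: X_def mult_ac)
  qed
  have "cell i i' (b ^ J) ` K \<subseteq> (\<Union>n\<in>F. cell i i' (b ^ J) ` (K \<inter> ball (x n) (\<rho> n)))" using F(2) by blast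
  then have "card (cell i i' (b ^ J) ` K) \<le> card (\<Union>n\<in>F. cell i i' (b ^ J) ` (K \<inter> ball (x n) (\<rho> n)))"
    using F by (intro card_mono finite_UN_I finite_subset[OF _ fin]) auto
  also have "\<dots> \<le> (\<Sum>n\<in>F. card (cell i i' (b ^ J) ` (K \<inter> ball (x n) (\<rho> n))))" by (rule card_UN_le[OF F(1)])
  finally have "N J \<le> (\<Sum>n\<in>F. real (card (cell i i' (b ^ J) ` (K \<inter> ball (x n) (\<rho> n)))))"
    by (simp only: N_def of_nat_le_iff of_nat_sum[symmetric])
  also have "\<dots> \<le> (\<Sum>n\<in>F. 9 * C * b powr u * N J * \<rho> n powr u)" by (intro sum_mono piece)
  also have "\<dots> = 9 * C * b powr u * N J * (\<Sum>n\<in>F. \<rho> n powr u)" by (simp only: sum_distrib_left)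
  also have "\<dots> \<le> 9 * C * b powr u * N J * (1 / (18 * C * b powr u))"
    using \<rho>s[OF F(1)] C N0[of J] by (intro mult_left_mono) (auto simp: \<epsilon>_def)
  also have "\<dots> = N J / 2" using C b by simp
  finally show False using N0[of J] by simp
qed

text \<open>A set of diameter at most \<open>\<delta>\<close> meets only one of two sets that are further apart.\<close>

lemma premeasure_Un_separated:
  assumes sep: "\<And>x y. x \<in> A \<Longrightarrow> y \<in> B \<Longrightarrow> \<delta> < dist x y"
  shows "hausdorff_premeasure s \<delta> A + hausdorff_premeasure s \<delta> B \<le> hausdorff_premeasure s \<delta> (A \<union> B)"
  unfolding hausdorff_premeasure_def[of s \<delta> "A \<union> B"]
proof (rule INF_greatest)
  fix U :: "nat \<Rightarrow> 'a set" assume "U \<in> {U. A \<union> B \<subseteq> (\<Union>i. U i) \<and> (\<forall>i. bounded (U i) \<and> diameter (U i) \<le> \<delta>)}"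
  then have U: "A \<union> B \<subseteq> (\<Union>i. U i)" "\<And>i. bounded (U i)" "\<And>i. diameter (U i) \<le> \<delta>" by auto
  define V where "V X i = (if U i \<inter> X = {} then {} else U i)" for X i
  have d0: "0 \<le> \<delta>" using U(3)[of 0] diameter_ge_0[OF U(2)[of 0]] by linarith
  have le: "hausdorff_premeasure s \<delta> X \<le> (\<Sum>i. diam_power s (V X i))" if X: "X \<subseteq> A \<union> B" for X
  proof (rule premeasure_le_suminf)
    show "X \<subseteq> (\<Union>i. V X i)"
    proof
      fix x assume "x \<in> X"
      then obtain i where "x \<in> U i" using X U(1) by blast
      then have "x \<in> V X i" using \<open>x \<in> X\<close> by (auto simp: V_def)
      then show "x \<in> (\<Union>i. V X i)" by blast
    qed
    show "bounded (V X i)" "diameter (V X i) \<le> \<delta>" for i using U d0 by (auto simp: V_def)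
  qed
  have disj: "U i \<inter> A = {} \<or> U i \<inter> B = {}" for i
  proof (rule ccontr)
    assume "\<not> ?thesis"
    then obtain x y where "x \<in> U i" "x \<in> A" "y \<in> U i" "y \<in> B" by blast
    then show False using sep[of x y] diameter_bounded_bound[OF U(2)[of i], of x y] U(3)[of i] by force
  qed
  have "hausdorff_premeasure s \<delta> A + hausdorff_premeasure s \<delta> B
    \<le> (\<Sum>i. diam_power s (V A i)) + (\<Sum>i. diam_power s (V B i))"
    by (intro add_mono le) auto
  also have "\<dots> = (\<Sum>i. diam_power s (V A i) + diam_power s (V B i))" by (rule suminf_add) auto
  also have "\<dots> \<le> (\<Sum>i. diam_power s (U i))"
  proof (intro suminf_le summableI)
    fix i show "diam_power s (V A i) + diam_power s (V B i) \<le> diam_power s (U i)"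
      using disj[of i] by (auto simp: V_def diam_power_def)
  qed
  finally show "hausdorff_premeasure s \<delta> A + hausdorff_premeasure s \<delta> B \<le> (\<Sum>i. diam_power s (U i))" .
qed

lemma hausdorff_measure_Un_separated:
  assumes d: "\<delta> > 0" and sep: "\<And>x y. x \<in> A \<Longrightarrow> y \<in> B \<Longrightarrow> \<delta> < dist x y"
  shows "hausdorff_measure s A + hausdorff_measure s B \<le> hausdorff_measure s (A \<union> B)"
proof -
  have pt: "hausdorff_premeasure s \<alpha> A + hausdorff_premeasure s \<beta> B \<le> hausdorff_measure s (A \<union> B)"
    if "\<alpha> > 0" "\<beta> > 0" for \<alpha> \<beta>
  proof -
    define \<gamma> where "\<gamma> = min \<delta> (min \<alpha> \<beta>)"
    have g: "\<gamma> > 0" "\<gamma> \<le> \<alpha>" "\<gamma> \<le> \<beta>" "\<gamma> \<le> \<delta>" using that d by (auto simp: \<gamma>_def)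
    have "hausdorff_premeasure s \<alpha> A + hausdorff_premeasure s \<beta> B
      \<le> hausdorff_premeasure s \<gamma> A + hausdorff_premeasure s \<gamma> B"
      by (intro add_mono premeasure_antimono g)
    also have "\<dots> \<le> hausdorff_premeasure s \<gamma> (A \<union> B)"
      by (rule premeasure_Un_separated, rule le_less_trans[OF g(4) sep])
    also have "\<dots> \<le> hausdorff_measure s (A \<union> B)"
      unfolding hausdorff_measure_def by (rule SUP_upper) (use g in auto)
    finally show ?thesis .
  qed
  have "hausdorff_measure s A + hausdorff_premeasure s \<beta> B \<le> hausdorff_measure s (A \<union> B)" if "\<beta> > 0" for \<beta>
    unfolding hausdorff_measure_def[of s A]
    by (subst ennreal_SUP_add_left[symmetric]) (use pt that in \<open>auto intro!: SUP_least\<close>)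
  then show ?thesis
    unfolding hausdorff_measure_def[of s B]
    by (subst add.commute, subst ennreal_SUP_add_left[symmetric]) (auto intro!: SUP_least simp: add.commute)
qed

lemma sum_hausdorff_measure_separated:
  assumes d: "\<delta> > 0" and F: "finite F"
    and sep: "\<And>i j x y. i \<in> F \<Longrightarrow> j \<in> F \<Longrightarrow> i \<noteq> j \<Longrightarrow> x \<in> A i \<Longrightarrow> y \<in> A j \<Longrightarrow> \<delta> < dist x y"
  shows "(\<Sum>i\<in>F. hausdorff_measure s (A i)) \<le> hausdorff_measure s (\<Union>i\<in>F. A i)"
  using F sep
proof (induction F rule: finite_induct)
  case (insert i F)
  have "(\<Sum>j\<in>insert i F. hausdorff_measure s (A j)) \<le> hausdorff_measure s (A i) + hausdorff_measure s (\<Union>j\<in>F. A j)"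
  proof -
    have "(\<Sum>j\<in>F. hausdorff_measure s (A j)) \<le> hausdorff_measure s (\<Union>j\<in>F. A j)"
      by (rule insert.IH) (use insert.prems in blast)
    then show ?thesis using insert.hyps by (simp add: add_left_mono)
  qed
  also have "\<dots> \<le> hausdorff_measure s (A i \<union> (\<Union>j\<in>F. A j))"
    by (rule hausdorff_measure_Un_separated[OF d]) (use insert in blast)
  finally show ?case by simp
qed simp

text \<open>
  Distinct cells whose indices agree modulo 2 are separated, so each of the four parity classes yields
  disjoint separated balls of radius comparable to \<open>1 / q\<close>. Each ball has measure at least of the order of \<open>q powr (- t)\<close>, and the
  total measure is finite.
\<close>

lemma ahlfors_regular_card_cells_le:
  fixes K :: "(real^2) set"
  assumes i: "i \<noteq> i'" and K: "ahlfors_regular t K" and t: "t > 0" and D: "diameter K > 0"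
  obtains c where "c > 0" "\<And>q. q \<ge> 1 / diameter K \<Longrightarrow> real (card (cell i i' q ` K)) \<le> c * q powr t"
proof -
  obtain C where C: "C \<ge> 1" "\<And>x r. x \<in> K \<Longrightarrow> 0 < r \<Longrightarrow> r \<le> diameter K \<Longrightarrow>
        ennreal (r powr t / C) \<le> hausdorff_measure t (K \<inter> cball x r) \<and>
        hausdorff_measure t (K \<inter> cball x r) \<le> ennreal (C * r powr t)" and cK: "compact K"
    using K unfolding ahlfors_regular_def by metis
  define D where "D = diameter K"
  have D0: "D > 0" using D by (simp add: D_def)
  have bK: "bounded K" using cK by (rule compact_imp_bounded)
  have "K \<noteq> {}" using D by (auto simp: diameter_def)
  then obtain x0 where x0: "x0 \<in> K" by blast
  have "K \<inter> cball x0 D = K"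
    using diameter_bounded_bound[OF bK x0] by (auto simp: D_def)
  then have HK: "hausdorff_measure t K \<le> ennreal (C * D powr t)" using C(2)[OF x0, of D] D0 by (simp add: D_def)
  define c where "c = 4 * C\<^sup>2 * D powr t * 4 powr t"
  show ?thesis
  proof (rule that[of c])
    show "c > 0" using C(1) D0 by (simp add: c_def)
    fix q assume q: "q \<ge> 1 / diameter K"
    have "1 / diameter K > 0" using D by simp
    then have q0: "q > 0" using q by linarith
    have qD: "1 / q \<le> D" using q q0 D0 by (simp add: D_def field_simps)
    define P where "P = cell i i' q ` K"
    have finP: "finite P" unfolding P_def by (rule finite_cells[OF bK])
    define cls where "cls e = {k\<in>P. (fst k mod 2, snd k mod 2) = e}" for e :: "int \<times> int"
    have each: "real (card (cls e)) \<le> C\<^sup>2 * D powr t * 4 powr t * q powr t" for e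
    proof -
      define x where "x k = (SOME z. z \<in> K \<and> cell i i' q z = k)" for k
      have x: "x k \<in> K" "cell i i' q (x k) = k" if "k \<in> cls e" for k
      proof -
        have "\<exists>z. z \<in> K \<and> cell i i' q z = k" using that by (auto simp: cls_def P_def)
        then have "x k \<in> K \<and> cell i i' q (x k) = k" unfolding x_def by (rule someI_ex)
        then show "x k \<in> K" "cell i i' q (x k) = k" by auto
      qed
      define r where "r = 1 / (4 * q)"
      have r: "0 < r" "r \<le> D" using q0 qD by (auto simp: r_def field_simps)
      have far: "4 * r < dist (x k) (x l)" if kl: "k \<in> cls e" "l \<in> cls e" "k \<noteq> l" for k l
      proof -
        have comp: "1 < q * \<bar>x k $ j - x l $ j\<bar>" if "\<lfloor>q * x k $ j\<rfloor> \<noteq> \<lfloor>q * x l $ j\<rfloor>" "\<lfloor>q * x k $ j\<rfloor> mod 2 = \<lfloor>q * x l $ j\<rfloor> mod 2" for j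
        proof -
          have "\<bar>\<lfloor>q * x k $ j\<rfloor> - \<lfloor>q * x l $ j\<rfloor>\<bar> \<ge> 2" using that by presburger
          then have "1 < \<bar>q * x k $ j - q * x l $ j\<bar>" by linarith
          then show ?thesis using q0 by (simp add: right_diff_distrib[symmetric] abs_mult)
        qed
        have "cell i i' q (x k) \<noteq> cell i i' q (x l)" "fst (cell i i' q (x k)) mod 2 = fst (cell i i' q (x l)) mod 2"
          "snd (cell i i' q (x k)) mod 2 = snd (cell i i' q (x l)) mod 2"
          using kl x(2)[OF kl(1)] x(2)[OF kl(2)] by (auto simp: cls_def)
        then obtain j where "1 < q * \<bar>x k $ j - x l $ j\<bar>"
          using comp[of i] comp[of i'] unfolding cell_def fst_conv snd_conv prod.inject by blast
        also have "\<dots> \<le> q * dist (x k) (x l)"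
          using component_le_norm_cart[of "x k - x l" j] q0 by (simp add: dist_norm)
        finally show ?thesis using q0 by (simp add: r_def field_simps)
      qed
      have finc: "finite (cls e)" using finP by (simp add: cls_def)
      have "(\<Sum>k\<in>cls e. ennreal (r powr t / C)) \<le> (\<Sum>k\<in>cls e. hausdorff_measure t (K \<inter> cball (x k) r))"
        by (intro sum_mono conjunct1[OF C(2)] x(1) r(1) r(2)[unfolded D_def])
      also have "\<dots> \<le> hausdorff_measure t (\<Union>k\<in>cls e. K \<inter> cball (x k) r)"
      proof (rule sum_hausdorff_measure_separated[OF r(1) finc])
        fix k l y z assume kl: "k \<in> cls e" "l \<in> cls e" "k \<noteq> l" "y \<in> K \<inter> cball (x k) r" "z \<in> K \<inter> cball (x l) r"
        have "4 * r < dist (x k) y + dist y z + dist z (x l)"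
          using far[OF kl(1-3)] dist_triangle[of "x k" "x l" y] dist_triangle[of y "x l" z] by linarith
        moreover have "dist (x k) y \<le> r" "dist z (x l) \<le> r" using kl(4,5) by (simp_all add: dist_commute)
        ultimately show "r < dist y z" using r(1) by linarith
      qed
      also have "\<dots> \<le> hausdorff_measure t K" by (rule hausdorff_measure_mono) auto
      also have "\<dots> \<le> ennreal (C * D powr t)" by (rule HK)
      finally have "ennreal (real (card (cls e)) * (r powr t / C)) \<le> ennreal (C * D powr t)"
        using C(1) by (simp add: ennreal_of_nat_eq_real_of_nat ennreal_mult'[symmetric])
      then have "real (card (cls e)) * (r powr t / C) \<le> C * D powr t"
        using C(1) by (subst (asm) ennreal_le_iff) auto
      then have "real (card (cls e)) \<le> C * D powr t / (r powr t / C)"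
        using C(1) r(1) by (subst pos_le_divide_eq) auto
      also have "\<dots> = C\<^sup>2 * D powr t * 4 powr t * q powr t"
        using q0 C(1) by (simp add: r_def powr_divide powr_mult power2_eq_square)
      finally show ?thesis .
    qed
    have "P \<subseteq> (\<Union>e\<in>{0,1::int} \<times> {0,1::int}. cls e)"
    proof
      fix k assume "k \<in> P"
      then have "k \<in> cls (fst k mod 2, snd k mod 2)" by (simp add: cls_def)
      moreover have "(fst k mod 2, snd k mod 2) \<in> {0,1::int} \<times> {0,1::int}" by auto
      ultimately show "k \<in> (\<Union>e\<in>{0,1::int} \<times> {0,1::int}. cls e)" by (rule UN_I[rotated])
    qed
    then have "card P \<le> card (\<Union>e\<in>{0,1::int} \<times> {0,1::int}. cls e)"
      by (rule card_mono[rotated]) (auto simp: cls_def finP)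
    also have "\<dots> \<le> (\<Sum>e\<in>{0,1::int} \<times> {0,1::int}. card (cls e))" by (rule card_UN_le) auto
    finally have "real (card P) \<le> (\<Sum>e\<in>{0,1::int} \<times> {0,1::int}. real (card (cls e)))"
      by (simp only: of_nat_le_iff of_nat_sum[symmetric])
    also have "\<dots> \<le> (\<Sum>e\<in>{0,1::int} \<times> {0,1::int}. C\<^sup>2 * D powr t * 4 powr t * q powr t)" by (intro sum_mono each)
    also have "\<dots> = c * q powr t" by (simp add: c_def)
    finally show "real (card (cell i i' q ` K)) \<le> c * q powr t" by (simp add: P_def)
  qed
qed

text \<open>
  If \<open>K\<close> has diameter 0, the regularity condition is void, but then there is at most one cell.
\<close>

lemma ahlfors_regular_eventually_few_cells:
  fixes K :: "(real^2) set"
  assumes i: "i \<noteq> i'" and K: "ahlfors_regular t K" and t: "t > 0" and b: "b \<ge> 2" and u: "u > t"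
  shows "eventually (\<lambda>j. real (card (cell i i' (b ^ j) ` K)) \<le> b powr (real j * u)) sequentially"
proof (cases "diameter K > 0")
  case True
  obtain c where c: "c > 0" "\<And>q. q \<ge> 1 / diameter K \<Longrightarrow> real (card (cell i i' q ` K)) \<le> c * q powr t"
    by (rule ahlfors_regular_card_cells_le[OF i K t True]) blast
  obtain m where m: "1 / diameter K < b ^ m" using real_arch_pow[of b] b by auto
  obtain n where n: "c < (b powr (u - t)) ^ n"
    using real_arch_pow[of "b powr (u - t)" c] b u gr_one_powr[of b "u - t"] by auto
  show ?thesis
    using eventually_ge_at_top[of "max m n"]
  proof eventually_elim
    case (elim j)
    have "b ^ m \<le> b ^ j" using b elim by (intro power_increasing) auto
    then have "real (card (cell i i' (b ^ j) ` K)) \<le> c * (b ^ j) powr t" using m by (intro c) linarith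
    moreover have "(b powr (u - t)) ^ n \<le> (b powr (u - t)) ^ j"
      using b u elim by (intro power_increasing ge_one_powr_ge_zero) auto
    then have "c * (b ^ j) powr t \<le> (b powr (u - t)) ^ j * (b ^ j) powr t"
      using n by (intro mult_right_mono) auto
    moreover have "(b powr (u - t)) ^ j * (b ^ j) powr t = b powr (real j * u)"
      using b by (simp add: powr_realpow[symmetric] powr_powr powr_add[symmetric] algebra_simps)
    ultimately show ?case by linarith
  qed
next
  case False
  have bK: "bounded K" using K unfolding ahlfors_regular_def by (auto intro: compact_imp_bounded)
  have "x = y" if "x \<in> K" "y \<in> K" for x y
    using diameter_bounded_bound[OF bK that] False zero_le_dist[of x y] dist_eq_0_iff[of x y] by linarith
  then have "\<forall>k\<in>cell i i' q ` K. \<forall>l\<in>cell i i' q ` K. k = l" for q by blast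
  then have one: "card (cell i i' q ` K) \<le> 1" for q
    using card_le_Suc0_iff_eq[OF finite_cells[OF bK, of i i' q]] unfolding One_nat_def by blast
  have "real (card (cell i i' (b ^ j) ` K)) \<le> b powr (real j * u)" for j
  proof -
    have "1 \<le> b powr (real j * u)" using b u t by (intro ge_one_powr_ge_zero) auto
    then show ?thesis using one[of "b ^ j"] by linarith
  qed
  then show ?thesis by simp
qed

section \<open>Null sets of directions\<close>

text \<open>
  A negligible set is split into pieces of length \<open>h\<close>, and each piece is covered by intervals of small total
  length inside the same range of length \<open>h\<close>; their images have diameter at most \<open>\<delta>\<close>.
\<close>

lemma hausdorff_null_lipschitz_image_negligible:
  fixes f :: "real \<Rightarrow> 'a::metric_space" and M :: "real set"
  assumes L: "\<And>x y. dist (f x) (f y) \<le> L * \<bar>x - y\<bar>" "L \<ge> 0" and M: "negligible M"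
  shows "hausdorff_measure 1 (f ` M) = 0"
  unfolding hausdorff_measure_eq_0_iff
proof (intro allI impI)
  fix \<delta> :: real assume \<delta>: "\<delta> > 0"
  define h where "h = \<delta> / (L + 1)"
  have h: "h > 0" "L * h \<le> \<delta>" using \<delta> L(2) by (auto simp: h_def field_simps)
  have piece: "hausdorff_premeasure 1 \<delta> (f ` (M \<inter> {a..a + h})) \<le> ennreal e" if e: "e > 0" for a e
  proof -
    define e' where "e' = e / (L + 1)"
    have e': "e' > 0" "L * e' \<le> e" using e L(2) by (auto simp: e'_def field_simps)
    define S where "S = M \<inter> {a..a + h}"
    have S: "negligible S" using M unfolding S_def by (rule negligible_subset) auto
    then have Sm: "S \<in> lmeasurable" "measure lebesgue S = 0"
      by (auto simp: negligible_iff_measure)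
    have "S \<subseteq> cbox a (a + h)" by (auto simp: S_def)
    from measurable_outer_intervals_bounded[OF Sm(1) this e'(1)]
    obtain \<D> where D: "countable \<D>"
        "\<And>K. K \<in> \<D> \<Longrightarrow> K \<subseteq> cbox a (a + h) \<and> K \<noteq> {} \<and> (\<exists>c d. K = cbox c d)"
        "pairwise (\<lambda>A B. interior A \<inter> interior B = {}) \<D>"
        "S \<subseteq> \<Union>\<D>" "\<Union>\<D> \<in> lmeasurable" "measure lebesgue (\<Union>\<D>) \<le> measure lebesgue S + e'"
      by metis
    \<comment> \<open>An enumeration of \<open>\<D>\<close> without repetitions, which may be finite, padded with empty sets.\<close>
    define V where "V n = (if n \<in> to_nat_on \<D> ` \<D> then from_nat_into \<D> n else {})" for n
    have V_cover: "(\<Union>n. V n) = \<Union>\<D>"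
    proof (intro equalityI subsetI)
      fix x assume "x \<in> (\<Union>n. V n)"
      then obtain n where "x \<in> V n" by blast
      then show "x \<in> \<Union>\<D>" using D(1) by (auto simp: V_def split: if_splits)
    next
      fix x assume "x \<in> \<Union>\<D>"
      then obtain K where K: "K \<in> \<D>" "x \<in> K" by blast
      then have "V (to_nat_on \<D> K) = K" using D(1) by (auto simp: V_def)
      then show "x \<in> (\<Union>n. V n)" using K by blast
    qed
    have V_D: "V n = {} \<or> V n \<in> \<D>" for n using D(1) by (auto simp: V_def)
    have V_box: "\<exists>c d. V n = {c..d} \<and> {c..d} \<subseteq> {a..a+h}" for n
    proof (cases "V n = {}")
      case True then show ?thesis by (intro exI[of _ 1] exI[of _ 0]) auto
    next
      case False
      then obtain c d where "V n = cbox c d" "V n \<subseteq> cbox a (a + h)" using V_D D(2) by metis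
      then show ?thesis by (intro exI[of _ c] exI[of _ d]) auto
    qed
    define I where "I n = interior (V n)" for n
    have Idisj: "disjoint_family I"
      unfolding disjoint_family_on_def
    proof (intro ballI impI)
      fix n m :: nat assume nm: "n \<noteq> m"
      show "I n \<inter> I m = {}"
      proof (cases "V n = {} \<or> V m = {}")
        case True then show ?thesis by (auto simp: I_def)
      next
        case False
        then have n: "n \<in> to_nat_on \<D> ` \<D>" "m \<in> to_nat_on \<D> ` \<D>" by (auto simp: V_def split: if_splits)
        then have "V n \<noteq> V m" using nm D(1) by (auto simp: V_def)
        then show ?thesis using D(3) V_D[of n] V_D[of m] False unfolding pairwise_def I_def by blast
      qed
    qed
    have em: "ennreal (L * diameter (V n)) = ennreal L * emeasure lebesgue (I n)" for n
    proof -
      obtain c d where "V n = {c..d}" using V_box by blast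
      then show ?thesis using L(2)
        by (cases "c \<le> d") (auto simp: I_def interior_atLeastAtMost_real ennreal_mult diameter_closed_interval)
    qed
    have dd: "dist (f x) (f y) \<le> \<delta>" if "x \<in> V n" "y \<in> V n" for x y n
    proof -
      obtain c d where cd: "V n = {c..d}" "{c..d} \<subseteq> {a..a+h}" using V_box by blast
      have "\<bar>x - y\<bar> \<le> h" using that cd by auto
      then have "L * \<bar>x - y\<bar> \<le> L * h" using L(2) by (rule mult_left_mono)
      then show ?thesis using L(1)[of x y] h(2) by linarith
    qed
    have "hausdorff_premeasure 1 \<delta> (f ` S) \<le> (\<Sum>n. diam_power 1 (f ` V n))"
    proof (rule premeasure_le_suminf)
      show "f ` S \<subseteq> (\<Union>n. f ` V n)" using D(4) V_cover by blast
      fix n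
      show "bounded (f ` V n)" unfolding bounded_two_points using dd by blast
      show "diameter (f ` V n) \<le> \<delta>"
        unfolding diameter_def using dd \<delta> by (auto intro!: cSUP_least)
    qed
    also have "\<dots> \<le> (\<Sum>n. ennreal (L * diameter (V n)))"
    proof (intro suminf_le summableI)
      fix n
      obtain c d where cd: "V n = {c..d}" using V_box by blast
      have "diameter (f ` V n) \<le> L * diameter (V n)" if "V n \<noteq> {}"
      proof -
        have "dist (f x) (f y) \<le> L * diameter (V n)" if "x \<in> V n" "y \<in> V n" for x y
        proof -
          have "\<bar>x - y\<bar> \<le> diameter (V n)"
            using diameter_bounded_bound[of "V n" x y] that cd by (simp add: dist_real_def)
          then show ?thesis using L(1)[of x y] mult_left_mono[OF _ L(2)] by (meson order_trans)
        qed
        then show ?thesis unfolding diameter_def[of "f ` V n"] using that by (auto intro!: cSUP_least)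
      qed
      moreover have "bounded (f ` V n)" unfolding bounded_two_points using dd[of _ n] by blast
      ultimately show "diam_power 1 (f ` V n) \<le> ennreal (L * diameter (V n))"
        using diameter_ge_0[of "f ` V n"] by (auto simp: diam_power_def intro!: ennreal_leI)
    qed
    also have "\<dots> = ennreal L * (\<Sum>n. emeasure lebesgue (I n))" unfolding em by simp
    also have "(\<Sum>n. emeasure lebesgue (I n)) = emeasure lebesgue (\<Union>n. I n)"
      by (rule suminf_emeasure[OF _ Idisj]) (auto simp: I_def)
    also have "emeasure lebesgue (\<Union>n. I n) \<le> emeasure lebesgue (\<Union>\<D>)"
    proof (rule emeasure_mono)
      show "(\<Union>n. I n) \<subseteq> \<Union>\<D>" unfolding V_cover[symmetric] I_def by (intro UN_mono interior_subset order_refl)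
      show "\<Union>\<D> \<in> sets lebesgue" using D(5) by (rule fmeasurableD)
    qed
    also have "emeasure lebesgue (\<Union>\<D>) \<le> ennreal e'"
      using D(5,6) Sm(2) by (simp add: emeasure_eq_measure2 ennreal_leI)
    also have "ennreal L * ennreal e' \<le> ennreal e"
      using e' L(2) by (simp add: ennreal_mult[symmetric] ennreal_leI)
    finally show ?thesis unfolding S_def by (simp add: mult_left_mono)
  qed
  have zero: "hausdorff_premeasure 1 \<delta> (f ` (M \<inter> {a..a + h})) = 0" for a
    using piece by (metis ennreal_le_epsilon add.left_neutral le_zero_eq)
  define a where "a n = real_of_int (int_decode n) * h" for n
  have "f ` M \<subseteq> (\<Union>n. f ` (M \<inter> {a n..a n + h}))"
  proof clarify
    fix x assume "x \<in> M"
    define n where "n = int_encode \<lfloor>x / h\<rfloor>"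
    have an: "a n = real_of_int \<lfloor>x / h\<rfloor> * h" by (simp add: a_def n_def)
    have "a n \<le> x" "x \<le> a n + h"
      using floor_divide_lower[OF h(1), of x] floor_divide_upper[OF h(1), of x]
      unfolding an by (simp_all add: distrib_right)
    then show "f x \<in> (\<Union>n. f ` (M \<inter> {a n..a n + h}))" using \<open>x \<in> M\<close> by (intro UN_I[of n] imageI) auto
  qed
  then have "hausdorff_premeasure 1 \<delta> (f ` M) \<le> hausdorff_premeasure 1 \<delta> (\<Union>n. f ` (M \<inter> {a n..a n + h}))"
    by (rule premeasure_mono)
  also have "\<dots> \<le> (\<Sum>n. hausdorff_premeasure 1 \<delta> (f ` (M \<inter> {a n..a n + h})))"
    by (rule premeasure_countable_subadditive)
  also have "\<dots> = 0" by (simp add: zero)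
  finally show "hausdorff_premeasure 1 \<delta> (f ` M) = 0" by simp
qed

lemma normalize_lipschitz:
  fixes v w :: "'a::real_normed_vector"
  assumes "norm v \<ge> 1" "norm w \<ge> 1"
  shows "norm (v /\<^sub>R norm v - w /\<^sub>R norm w) \<le> 2 * norm (v - w)"
proof -
  have v: "norm v > 0" and w: "norm w > 0" using assms by linarith+
  have "v /\<^sub>R norm v - w /\<^sub>R norm w = (v - w) /\<^sub>R norm v + (inverse (norm v) - inverse (norm w)) *\<^sub>R w"
    by (simp add: algebra_simps)
  also have "norm \<dots> \<le> norm ((v - w) /\<^sub>R norm v) + norm ((inverse (norm v) - inverse (norm w)) *\<^sub>R w)"
    by (rule norm_triangle_ineq)
  also have "norm ((v - w) /\<^sub>R norm v) \<le> norm (v - w)"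
  proof -
    have "norm (v - w) / norm v \<le> norm (v - w) / 1" using assms(1) v by (intro divide_left_mono) auto
    then show ?thesis by (simp add: divide_inverse mult.commute)
  qed
  also have "norm ((inverse (norm v) - inverse (norm w)) *\<^sub>R w) = \<bar>norm w - norm v\<bar> / norm v"
    using v w by (simp add: abs_mult divide_simps)
  also have "\<dots> \<le> \<bar>norm w - norm v\<bar> / 1" using assms(1) by (intro divide_left_mono) auto
  also have "\<dots> \<le> norm (v - w)" using norm_triangle_ineq3[of w v] by (simp add: norm_minus_commute)
  finally show ?thesis by simp
qed

text \<open>
  A direction is, up to its sign, the normalisation of the vector with coordinates \<open>m\<close> and 1, a Lipschitz
  function of its slope \<open>m\<close>.
\<close>

lemma hausdorff_null_directions:
  fixes i i' :: 2 and M :: "real set"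
  assumes i: "i \<noteq> i'" and M: "negligible M"
  shows "hausdorff_measure 1 {e \<in> sphere (0::real^2) 1. e $ i' \<noteq> 0 \<and> e $ i / e $ i' \<in> M} = 0"
proof -
  define v where "v m = m *\<^sub>R axis i 1 + axis i' (1::real)" for m :: real
  define f where "f m = v m /\<^sub>R norm (v m)" for m
  have vi': "v m $ i' = 1" "v m $ i = m" for m using i by (auto simp: v_def axis_def)
  have v1: "norm (v m) \<ge> 1" for m using component_le_norm_cart[of "v m" i'] vi' by simp
  have lip: "dist (f x) (f y) \<le> 2 * \<bar>x - y\<bar>" for x y
  proof -
    have "v x - v y = (x - y) *\<^sub>R axis i 1" by (simp add: v_def algebra_simps)
    then have "norm (v x - v y) = \<bar>x - y\<bar>" by simp
    then show ?thesis using normalize_lipschitz[OF v1 v1, of x y] by (simp add: f_def dist_norm)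
  qed
  have lip': "dist (- f x) (- f y) \<le> 2 * \<bar>x - y\<bar>" for x y using lip[of x y] by (simp add: dist_minus)
  have "{e \<in> sphere (0::real^2) 1. e $ i' \<noteq> 0 \<and> e $ i / e $ i' \<in> M} \<subseteq> f ` M \<union> (\<lambda>m. - f m) ` M"
  proof
    fix e assume "e \<in> {e \<in> sphere (0::real^2) 1. e $ i' \<noteq> 0 \<and> e $ i / e $ i' \<in> M}"
    then have e: "norm e = 1" "e $ i' \<noteq> 0" "e $ i / e $ i' \<in> M" by auto
    define m where "m = e $ i / e $ i'"
    have ev: "e = e $ i' *\<^sub>R v m"
      unfolding vec_eq_iff all_two[OF i] using e(2) by (simp add: vi' m_def)
    then have "1 = \<bar>e $ i'\<bar> * norm (v m)" using e(1) by (metis norm_scaleR)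
    then have "inverse (norm (v m)) = \<bar>e $ i'\<bar>" by (intro inverse_unique) (simp add: mult.commute)
    then have "f m = \<bar>e $ i'\<bar> *\<^sub>R v m" by (simp add: f_def)
    then have "e = f m \<or> e = - f m" using ev by (cases "e $ i' \<ge> 0") (auto simp: abs_if scaleR_minus_left)
    then show "e \<in> f ` M \<union> (\<lambda>m. - f m) ` M" using e(3) by (auto simp: m_def)
  qed
  then have "hausdorff_measure 1 {e \<in> sphere (0::real^2) 1. e $ i' \<noteq> 0 \<and> e $ i / e $ i' \<in> M}
    \<le> hausdorff_measure 1 (f ` M \<union> (\<lambda>m. - f m) ` M)"
    by (rule hausdorff_measure_mono)
  also have "\<dots> = 0"
    by (intro hausdorff_null_Un hausdorff_null_lipschitz_image_negligible[where L=2] M lip lip') auto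
  finally show ?thesis by simp
qed

section \<open>Points on rich slices\<close>

text \<open>
  Both conditions must hold at the same scales: for the lower box dimension the first one, for the upper box
  dimension the second one is known only at infinitely many scales.
\<close>

definition rich_points :: "2 \<Rightarrow> 2 \<Rightarrow> (real^2) set \<Rightarrow> real \<Rightarrow> real \<Rightarrow> real \<Rightarrow> real \<Rightarrow> real \<Rightarrow> (real^2) set" where
  "rich_points i i' K b t s \<epsilon> m = {z\<in>K. \<exists>\<^sub>\<infinity>j.
     real (card (cell i i' (b ^ j) ` K)) \<le> b powr (real j * (t + \<epsilon>)) \<and>
     b powr (real j * (s - \<epsilon>)) \<le> real (card (cell i i' (b ^ j) ` {w\<in>K. w $ i - m * w $ i' = z $ i - m * z $ i'}))}"

text \<open>
  On rich slices the density exponent is \<open>s - t + 1\<close> up to \<open>2 * \<epsilon>\<close>. The proof interpolates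
  \<open>1 - u < h < h' < s - t + 1\<close>: the first inequality makes the limsup set of bad cells null for the exponent \<open>u\<close>,
  and the last two put the rich points into it.
\<close>

lemma AE_rich_points_null:
  assumes i: "i \<noteq> i'" and K: "K \<noteq> {}" "sub_uniformly_distributed K"
    and s: "max (t - 1) 0 < s" and u: "max (t - s) 0 < u"
  obtains L \<epsilon> where "L \<ge> (1::nat)" "\<epsilon> > 0" "\<epsilon> < s"
    "AE m in lborel. \<bar>m\<bar> \<le> 1 \<longrightarrow> hausdorff_measure u (rich_points i i' K (2 ^ L) t s \<epsilon> m) = 0"
proof -
  have bK: "bounded K" using K(2) by (simp add: sub_uniformly_distributed_def)
  define \<eta> where "\<eta> = s - t + 1"
  have \<eta>: "\<eta> > 0" "1 - u < \<eta>" using s u by (auto simp: \<eta>_def)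
  define h where "h = max (\<eta> / 2) ((\<eta> + 1 - u) / 2)"
  have h1: "\<eta> / 2 \<le> h" unfolding h_def by (rule max.cobounded1)
  have h2: "(\<eta> + 1 - u) / 2 \<le> h" unfolding h_def by (rule max.cobounded2)
  have h: "h > 0" "h < \<eta>" using \<eta> h1 by (auto simp: h_def)
  have "1 - h \<le> (1 - \<eta> + u) / 2" using h2 by (simp add: field_simps)
  also have "\<dots> < u" using \<eta>(2) by (simp add: field_simps)
  finally have hu: "u > 1 - h" .
  define h' where "h' = (h + \<eta>) / 2"
  define \<epsilon> where "\<epsilon> = min ((\<eta> - h') / 2) (s / 2)"
  have h': "h < h'" "h' < \<eta>" using h by (auto simp: h'_def)
  have "\<epsilon> \<le> (\<eta> - h') / 2" unfolding \<epsilon>_def by (rule min.cobounded1)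
  then have "2 * \<epsilon> \<le> \<eta> - h'" by simp
  moreover have "\<epsilon> > 0" "\<epsilon> < s" using h' s by (auto simp: \<epsilon>_def)
  ultimately have \<epsilon>: "\<epsilon> > 0" "\<epsilon> < s" "2 * \<epsilon> \<le> \<eta> - h'" by auto
  from sub_uniformly_distributed_cells[OF i K(2)]
  obtain C where C: "C > 0" and unif: "\<And>L j j' z. j \<le> j' \<Longrightarrow> z \<in> K \<Longrightarrow>
    real (card (cell i i' ((2 ^ L) ^ j) ` K)) *
      real (card (cell i i' ((2 ^ L) ^ j') ` {w\<in>K. cell i i' ((2 ^ L) ^ j) w = cell i i' ((2 ^ L) ^ j) z}))
    \<le> C * real (card (cell i i' ((2 ^ L) ^ j') ` K))" by blast
  \<comment> \<open>The base is so large that one good step, which costs the factor \<open>12 * C\<close>, stays below \<open>b powr h\<close>.\<close>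
  obtain n where n: "12 * C < (2 powr h) ^ n"
    using real_arch_pow[of "2 powr h" "12 * C"] h(1) by auto
  define L where "L = max 3 n"
  define b :: nat where "b = 2 ^ L"
  have rb: "real b = 2 ^ L" by (simp add: b_def)
  have "(2::nat) ^ 3 \<le> 2 ^ L" by (intro power_increasing) (auto simp: L_def)
  then have b6: "b \<ge> 6" by (simp add: b_def)
  have "(2 powr h) ^ n \<le> (2 powr h) ^ L"
    using h(1) by (intro power_increasing ge_one_powr_ge_zero) (auto simp: L_def)
  also have "\<dots> = real b powr h"
    unfolding rb by (simp add: powr_realpow[symmetric] powr_powr mult.commute)
  finally have bC: "12 * C \<le> real b powr h" using n by linarith
  obtain D0 where D0: "\<And>x. x \<in> K \<Longrightarrow> norm x \<le> D0" using bK bounded_iff by metis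
  define D where "D = nat \<lceil>2 * D0 + 1\<rceil> + 1"
  have D: "2 * D0 + 1 \<le> real D" "D \<ge> 1" by (auto simp: D_def) linarith
  define P where "P j = cell i i' (real b ^ j) ` K" for j
  interpret cell_tree b D C P
  proof
    show "6 \<le> b" "1 \<le> D" by fact+
    show "finite (P j)" "P j \<noteq> {}" for j unfolding P_def using K(1) bK by (auto intro: finite_cells)
    show "parent b ` P (Suc j) = P j" for j
      unfolding P_def image_image using b6 by (simp add: parent_cell del: power_Suc)
    show "\<bar>snd k - snd l\<bar> \<le> int (D * b ^ j)" if "k \<in> P j" "l \<in> P j" for k l j
      using cell_spread[OF D0 D(1) _ that[unfolded P_def]] b6 by simp
    show "real (card (P j)) * real (card {l\<in>P (Suc j). parent b l = p}) \<le> C * real (card (P (Suc j)))" if p: "p \<in> P j" for p j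
    proof -
      obtain z where z: "z \<in> K" "p = cell i i' (real b ^ j) z" using p by (auto simp: P_def)
      have "{l\<in>P (Suc j). parent b l = p} = cell i i' (real b ^ Suc j) ` {w\<in>K. cell i i' (real b ^ j) w = cell i i' (real b ^ j) z}"
        unfolding P_def z(2) using b6 by (auto simp: parent_cell simp del: power_Suc)
      then show ?thesis using unif[of j "Suc j" z L] z(1) unfolding P_def rb by simp
    qed
  qed
  have null: "hausdorff_measure u (rich_points i i' K (2 ^ L) t s \<epsilon> m) = 0"
    if m: "\<bar>m\<bar> \<le> 1" and sm: "summable (\<lambda>j. real (card (bad h j m)) * ((1 / real b) ^ j) powr u)" for m
  proof (rule hausdorff_null_limsup[where I = "\<lambda>j. bad h j m" and r = "\<lambda>j. (1 / real b) ^ j" and c = 2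
        and Q = "\<lambda>j c. {x. cell i i' (real b ^ j) x = c}"])
    show "0 < u" using u by simp
    show "finite (bad h j m)" for j by (rule finite_bad)
    show "0 < (1 / real b) ^ j" for j using b6 by simp
    show "(\<lambda>j. (1 / real b) ^ j) \<longlonglongrightarrow> 0" using b6 by (intro LIMSEQ_realpow_zero) auto
    show "bounded {x. cell i i' (real b ^ j) x = c}" for j c using b6 by (intro bounded_cell i) auto
    show "diameter {x. cell i i' (real b ^ j) x = c} \<le> 2 * (1 / real b) ^ j" for j c
      using diameter_cell[OF i, of "real b ^ j" c] b6 by (simp add: power_one_over)
    show "\<exists>\<^sub>\<infinity>j. \<exists>c\<in>bad h j m. z \<in> {x. cell i i' (real b ^ j) x = c}" if z: "z \<in> rich_points i i' K (2 ^ L) t s \<epsilon> m" for z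
    proof -
      have zK: "z \<in> K" using z by (simp add: rich_points_def)
      have rich: "\<exists>\<^sub>\<infinity>j. level j h' \<le> real (window_count m (P j) 5 (shear m (cell i i' (real b ^ j) z)))"
      proof (rule INFM_mono)
        show "\<exists>\<^sub>\<infinity>j. real (card (P j)) \<le> real b powr (real j * (t + \<epsilon>)) \<and>
          real b powr (real j * (s - \<epsilon>)) \<le> real (card (cell i i' (real b ^ j) ` {w\<in>K. w $ i - m * w $ i' = z $ i - m * z $ i'}))"
          using z unfolding rich_points_def P_def rb by blast
        fix j assume j: "real (card (P j)) \<le> real b powr (real j * (t + \<epsilon>)) \<and>
          real b powr (real j * (s - \<epsilon>)) \<le> real (card (cell i i' (real b ^ j) ` {w\<in>K. w $ i - m * w $ i' = z $ i - m * z $ i'}))"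
        have "level j h' \<le> real b powr (real j * (t + \<epsilon>)) * real b powr (real j * (h' - 1))"
          unfolding level_def using j by (intro mult_right_mono) auto
        also have "\<dots> = real b powr (real j * (t + \<epsilon> + h' - 1))" by (simp add: powr_add[symmetric] algebra_simps)
        also have "\<dots> \<le> real b powr (real j * (s - \<epsilon>))"
          using \<epsilon>(3) b6 by (intro powr_mono mult_left_mono) (auto simp: \<eta>_def)
        also have "\<dots> \<le> real (card (cell i i' (real b ^ j) ` {w\<in>K. w $ i - m * w $ i' = z $ i - m * z $ i'}))" using j by blast
        also have "\<dots> \<le> real (window_count m (P j) 5 (shear m (cell i i' (real b ^ j) z)))"
          unfolding P_def using b6 by (intro of_nat_mono slice_cells_le_window m bK) auto
        finally show "level j h' \<le> real (window_count m (P j) 5 (shear m (cell i i' (real b ^ j) z)))" .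
      qed
      have "\<exists>\<^sub>\<infinity>j. cell i i' (real b ^ j) z \<in> bad h j m"
      proof (rule path_bad_infinitely_often[OF m h'(1) bC _ _ rich])
        show "cell i i' (real b ^ j) z \<in> P j" for j unfolding P_def using zK by (rule imageI)
        show "cell i i' (real b ^ j) z = parent b (cell i i' (real b ^ Suc j) z)" for j
          by (rule parent_cell[symmetric]) (use b6 in simp)
      qed
      then show ?thesis by (rule INFM_mono) blast
    qed
  qed (use sm in auto)
  have "AE m in lborel. \<bar>m\<bar> \<le> 1 \<longrightarrow> hausdorff_measure u (rich_points i i' K (2 ^ L) t s \<epsilon> m) = 0"
    using summable_bad[OF hu] by (rule AE_mp) (use null in \<open>auto intro!: AE_I2\<close>)
  then show ?thesis using \<epsilon> by (intro that[of L \<epsilon>]) (auto simp: L_def)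
qed

text \<open>
  The null set of slopes in \<open>AE_rich_points_null\<close> depends on the exponent \<open>u\<close>; countably many \<open>u\<close> that
  decrease to the bound suffice.
\<close>

lemma AE_hausdorff_dim_le:
  assumes i: "i \<noteq> i'" and K: "sub_uniformly_distributed K"
    and s: "max (t - 1) 0 < s"
    and Z: "\<And>m L \<epsilon>. L \<ge> (1::nat) \<Longrightarrow> 0 < \<epsilon> \<Longrightarrow> \<epsilon> < s \<Longrightarrow> Z m \<subseteq> rich_points i i' K (2 ^ L) t s \<epsilon> m"
  shows "AE m in lborel. \<bar>m\<bar> \<le> 1 \<longrightarrow> hausdorff_dim (Z m) \<le> ereal (max (t - s) 0)"
proof (cases "K = {}")
  case True
  have Z0: "Z m = {}" for m using Z[of 1 "s / 2" m] s True by (auto simp: rich_points_def)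
  have "hausdorff_dim (Z m) \<le> ereal (max (t - s) 0)" for m
    unfolding Z0 hausdorff_dim_empty zero_ereal_def ereal_less_eq by simp
  then show ?thesis by simp
next
  case False
  define u where "u n = max (t - s) 0 + 1 / real (Suc n)" for n
  have u: "max (t - s) 0 < u n" for n by (simp add: u_def)
  have "AE m in lborel. \<bar>m\<bar> \<le> 1 \<longrightarrow> hausdorff_dim (Z m) \<le> ereal (u n)" for n
  proof -
    obtain L \<epsilon> where L: "L \<ge> (1::nat)" "\<epsilon> > 0" "\<epsilon> < s"
      and AE: "AE m in lborel. \<bar>m\<bar> \<le> 1 \<longrightarrow> hausdorff_measure (u n) (rich_points i i' K (2 ^ L) t s \<epsilon> m) = 0"
      by (rule AE_rich_points_null[OF i False K s u[of n]])
    show ?thesis using AE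
    proof (rule AE_mp, intro AE_I2 impI)
      fix m :: real assume a: "\<bar>m\<bar> \<le> 1 \<longrightarrow> hausdorff_measure (u n) (rich_points i i' K (2 ^ L) t s \<epsilon> m) = 0" "\<bar>m\<bar> \<le> 1"
      have "hausdorff_measure (u n) (Z m) \<le> hausdorff_measure (u n) (rich_points i i' K (2 ^ L) t s \<epsilon> m)"
        by (intro hausdorff_measure_mono Z L)
      then have "hausdorff_measure (u n) (Z m) = 0" using a by simp
      then show "hausdorff_dim (Z m) \<le> ereal (u n)" using u[of n] by (intro hausdorff_dim_le) auto
    qed
  qed
  then have "AE m in lborel. \<forall>n. \<bar>m\<bar> \<le> 1 \<longrightarrow> hausdorff_dim (Z m) \<le> ereal (u n)" unfolding AE_all_countable ..
  then show ?thesis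
  proof (rule AE_mp, intro AE_I2 impI)
    fix m :: real assume a: "\<forall>n. \<bar>m\<bar> \<le> 1 \<longrightarrow> hausdorff_dim (Z m) \<le> ereal (u n)" "\<bar>m\<bar> \<le> 1"
    have "(\<lambda>n. 1 / real (Suc n)) \<longlonglongrightarrow> 0" using LIMSEQ_inverse_real_of_nat by (simp add: inverse_eq_divide)
    then have "(\<lambda>n. max (t - s) 0 + 1 / real (Suc n)) \<longlonglongrightarrow> max (t - s) 0 + 0" by (intro tendsto_add tendsto_const)
    then have "(\<lambda>n. ereal (u n)) \<longlonglongrightarrow> ereal (max (t - s) 0)" 
      unfolding u_def add_0_right by (rule tendsto_ereal)
    then show "hausdorff_dim (Z m) \<le> ereal (max (t - s) 0)"
      by (rule LIMSEQ_le_const) (use a in auto)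
  qed
qed

text \<open>
  The slope is measured against the larger coordinate of the direction, so that it lies in \<open>{-1..1}\<close>.
\<close>

lemma almost_every_directionI:
  fixes K :: "(real^2) set"
  assumes AE: "\<And>i i' :: 2. i \<noteq> i' \<Longrightarrow> AE m in lborel. \<bar>m\<bar> \<le> 1 \<longrightarrow>
    hausdorff_dim {z\<in>K. R {w\<in>K. w $ i - m * w $ i' = z $ i - m * z $ i'}} \<le> c"
  shows "almost_every_direction (\<lambda>e. hausdorff_dim {z\<in>K. R (K \<inter> line_through e z)} \<le> c)"
proof -
  define M where "M i i' = {m. \<not> (\<bar>m\<bar> \<le> 1 \<longrightarrow>
    hausdorff_dim {z\<in>K. R {w\<in>K. w $ i - m * w $ i' = z $ i - m * z $ i'}} \<le> c)}" for i i' :: 2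
  define X where "X i i' = {e \<in> sphere (0::real^2) 1. e $ i' \<noteq> 0 \<and> e $ i / e $ i' \<in> M i i'}" for i i'
  have null: "hausdorff_measure 1 (X i i') = 0" if ii: "i \<noteq> i'" for i i'
  proof -
    obtain N where N: "M i i' \<subseteq> N" "N \<in> null_sets lborel"
      using AE[OF ii] unfolding eventually_ae_filter M_def by auto
    then have "negligible N" using null_sets_completionI negligible_iff_null_sets by blast
    then have "negligible (M i i')" using N(1) by (rule negligible_subset)
    then show ?thesis unfolding X_def using ii by (intro hausdorff_null_directions)
  qed
  have slice: "K \<inter> line_through e z = {w\<in>K. w $ i - (e $ i / e $ i') * w $ i' = z $ i - (e $ i / e $ i') * z $ i'}"
    if i: "i \<noteq> i'" and e: "e $ i' \<noteq> 0" for i i' :: 2 and e z :: "real^2"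
  proof -
    have "w \<in> line_through e z \<longleftrightarrow> w $ i - (e $ i / e $ i') * w $ i' = z $ i - (e $ i / e $ i') * z $ i'" for w
    proof
      assume "w \<in> line_through e z"
      then obtain a where "w = z + a *\<^sub>R e" by (auto simp: line_through_def span_singleton)
      then show "w $ i - (e $ i / e $ i') * w $ i' = z $ i - (e $ i / e $ i') * z $ i'"
        using e by (simp add: field_simps)
    next
      assume w: "w $ i - (e $ i / e $ i') * w $ i' = z $ i - (e $ i / e $ i') * z $ i'"
      define a where "a = (w $ i' - z $ i') / e $ i'"
      have "w = z + a *\<^sub>R e"
        unfolding vec_eq_iff all_two[OF i] using e w by (simp add: a_def field_simps)
      then show "w \<in> line_through e z" by (auto simp: line_through_def span_singleton)
    qed
    then show ?thesis by blast
  qed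
  have "{e \<in> sphere 0 1. \<not> hausdorff_dim {z\<in>K. R (K \<inter> line_through e z)} \<le> c} \<subseteq> X 1 2 \<union> X 2 1"
  proof
    fix e :: "real^2" assume "e \<in> {e \<in> sphere 0 1. \<not> hausdorff_dim {z\<in>K. R (K \<inter> line_through e z)} \<le> c}"
    then have e: "e \<in> sphere 0 1" "\<not> hausdorff_dim {z\<in>K. R (K \<inter> line_through e z)} \<le> c" by auto
    have in_X: "e \<in> X i i'" if i: "i \<noteq> i'" and le: "\<bar>e $ i\<bar> \<le> \<bar>e $ i'\<bar>" for i i' :: 2
    proof -
      have e0: "e $ i' \<noteq> 0"
      proof
        assume "e $ i' = 0"
        then have "e = 0" unfolding vec_eq_iff all_two[OF i] using le by simp
        then show False using e(1) by simp
      qed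
      have "\<bar>e $ i / e $ i'\<bar> \<le> 1" using le e0 by simp
      then have "e $ i / e $ i' \<in> M i i'" using e(2) unfolding M_def slice[OF i e0] by blast
      then show ?thesis using e(1) e0 by (simp add: X_def)
    qed
    show "e \<in> X 1 2 \<union> X 2 1"
      using in_X[of 1 2] in_X[of 2 1] by (cases "\<bar>e $ 1\<bar> \<le> \<bar>e $ 2\<bar>") auto
  qed
  then have "hausdorff_measure 1 {e \<in> sphere 0 1. \<not> hausdorff_dim {z\<in>K. R (K \<inter> line_through e z)} \<le> c}
    \<le> hausdorff_measure 1 (X 1 2 \<union> X 2 1)" by (rule hausdorff_measure_mono)
  also have "\<dots> = 0" by (intro hausdorff_null_Un null) auto
  finally show ?thesis unfolding almost_every_direction_def by simp
qed

text \<open>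
  The slice is rich at all small scales, and \<open>K\<close> has few cells at infinitely many of them.
\<close>

lemma lower_slices_rich:
  fixes K :: "(real^2) set"
  assumes i: "i \<noteq> i'" and K: "compact K" "sub_uniformly_distributed K" and dim: "hausdorff_dim K = ereal t" "0 < t"
    and L: "L \<ge> (1::nat)" and \<epsilon>: "0 < \<epsilon>" "\<epsilon> < s"
  shows "{z\<in>K. ereal s \<le> lower_box_dim {w\<in>K. w $ i - m * w $ i' = z $ i - m * z $ i'}} \<subseteq> rich_points i i' K (2 ^ L) t s \<epsilon> m"
proof
  fix z assume z: "z \<in> {z\<in>K. ereal s \<le> lower_box_dim {w\<in>K. w $ i - m * w $ i' = z $ i - m * z $ i'}}"
  define E where "E = {w\<in>K. w $ i - m * w $ i' = z $ i - m * z $ i'}"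
  have bE: "bounded E" using compact_imp_bounded[OF K(1)] by (rule bounded_subset) (auto simp: E_def)
  define b :: real where "b = 2 ^ L"
  have b: "b \<ge> 2" using L by (simp add: b_def self_le_power)
  have "hausdorff_dim K < ereal (t + \<epsilon>)" using dim \<epsilon> by simp
  then obtain u where u: "0 \<le> u" "hausdorff_measure u K = 0" "u < t + \<epsilon>"
    unfolding hausdorff_dim_def by (auto simp: INF_less_iff)
  have "ereal t \<le> ereal u" using hausdorff_dim_le[OF u(1,2)] dim by simp
  then have u0: "u > 0" using dim(2) by simp
  obtain C where C: "C > 0" and unif: "\<And>L j j' z. j \<le> j' \<Longrightarrow> z \<in> K \<Longrightarrow>
    real (card (cell i i' ((2 ^ L) ^ j) ` K)) *
      real (card (cell i i' ((2 ^ L) ^ j') ` {w\<in>K. cell i i' ((2 ^ L) ^ j) w = cell i i' ((2 ^ L) ^ j) z}))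
    \<le> C * real (card (cell i i' ((2 ^ L) ^ j') ` K))"
    using sub_uniformly_distributed_cells[OF i K(2)] by blast
  have "\<exists>\<^sub>\<infinity>j. real (card (cell i i' (b ^ j) ` K)) \<le> b powr (real j * u)"
    by (rule few_cells_infinitely_often[OF b K(1) _ C _ u0 u(2)]) (use z unif in \<open>auto simp: b_def\<close>)
  moreover have "eventually (\<lambda>j. b powr (real j * (s - \<epsilon>)) \<le> real (card (cell i i' (b ^ j) ` E))) cofinite"
    unfolding cofinite_eq_sequentially by (rule lower_box_dim_cells[OF i b bE, of _ s]) (use \<epsilon> z in \<open>auto simp: E_def\<close>)
  ultimately have "\<exists>\<^sub>\<infinity>j. real (card (cell i i' (b ^ j) ` K)) \<le> b powr (real j * u) \<and>
     b powr (real j * (s - \<epsilon>)) \<le> real (card (cell i i' (b ^ j) ` E))"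
    by (rule frequently_eventually_conj[THEN frequently_rev_mp]) (auto intro: always_eventually)
  then have "\<exists>\<^sub>\<infinity>j. real (card (cell i i' (b ^ j) ` K)) \<le> b powr (real j * (t + \<epsilon>)) \<and>
     b powr (real j * (s - \<epsilon>)) \<le> real (card (cell i i' (b ^ j) ` E))"
  proof (rule INFM_mono)
    fix j
    have "b powr (real j * u) \<le> b powr (real j * (t + \<epsilon>))" using b u(3) by (intro powr_mono mult_left_mono) auto
    then show "real (card (cell i i' (b ^ j) ` K)) \<le> b powr (real j * u) \<and>
     b powr (real j * (s - \<epsilon>)) \<le> real (card (cell i i' (b ^ j) ` E)) \<Longrightarrow>
       real (card (cell i i' (b ^ j) ` K)) \<le> b powr (real j * (t + \<epsilon>)) \<and>
     b powr (real j * (s - \<epsilon>)) \<le> real (card (cell i i' (b ^ j) ` E))" by linarith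
  qed
  then show "z \<in> rich_points i i' K (2 ^ L) t s \<epsilon> m"
    using z unfolding rich_points_def E_def b_def by blast
qed

text \<open>
  The slice is rich at infinitely many scales only, so \<open>K\<close> must have few cells at all small scales.
\<close>

lemma upper_slices_rich:
  fixes K :: "(real^2) set"
  assumes i: "i \<noteq> i'" and K: "ahlfors_regular t K" and t: "0 < t"
    and L: "L \<ge> (1::nat)" and \<epsilon>: "0 < \<epsilon>" "\<epsilon> < s"
  shows "{z\<in>K. ereal s \<le> upper_box_dim {w\<in>K. w $ i - m * w $ i' = z $ i - m * z $ i'}} \<subseteq> rich_points i i' K (2 ^ L) t s \<epsilon> m"
proof
  fix z assume z: "z \<in> {z\<in>K. ereal s \<le> upper_box_dim {w\<in>K. w $ i - m * w $ i' = z $ i - m * z $ i'}}"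
  define E where "E = {w\<in>K. w $ i - m * w $ i' = z $ i - m * z $ i'}"
  have "compact K" using K by (simp add: ahlfors_regular_def)
  then have bE: "bounded E" by (rule bounded_subset[OF compact_imp_bounded]) (auto simp: E_def)
  define b :: real where "b = 2 ^ L"
  have b: "b \<ge> 2" using L by (simp add: b_def self_le_power)
  have "\<exists>\<^sub>\<infinity>j. b powr (real j * (s - \<epsilon>)) \<le> real (card (cell i i' (b ^ j) ` E))"
    by (rule upper_box_dim_cells[OF i b bE, of _ s]) (use \<epsilon> z in \<open>auto simp: E_def\<close>)
  moreover have "eventually (\<lambda>j. real (card (cell i i' (b ^ j) ` K)) \<le> b powr (real j * (t + \<epsilon>))) cofinite"
    unfolding cofinite_eq_sequentially by (rule ahlfors_regular_eventually_few_cells[OF i K t b]) (use \<epsilon> in simp)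
  ultimately have "\<exists>\<^sub>\<infinity>j. real (card (cell i i' (b ^ j) ` K)) \<le> b powr (real j * (t + \<epsilon>)) \<and>
     b powr (real j * (s - \<epsilon>)) \<le> real (card (cell i i' (b ^ j) ` E))"
    by (rule frequently_eventually_conj[THEN frequently_rev_mp]) (auto intro: always_eventually)
  then show "z \<in> rich_points i i' K (2 ^ L) t s \<epsilon> m"
    using z unfolding rich_points_def E_def b_def by blast
qed

theorem proposition4p7:
  fixes K :: "(real^2) set" and t :: real
  assumes "compact K"
    and "sub_uniformly_distributed K"
    and "hausdorff_dim K = ereal t"
    and "0 < t" and "t < 2"
  shows "(\<forall>s::real. max (t - 1) 0 < s \<and> s \<le> 1 \<longrightarrow>
            almost_every_direction (\<lambda>e. hausdorff_dim (lower_H K e s) \<le> ereal (max (t - s) 0))) \<and>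
         (ahlfors_regular t K \<longrightarrow>
           (\<forall>s::real. max (t - 1) 0 < s \<and> s \<le> 1 \<longrightarrow>
             almost_every_direction (\<lambda>e. hausdorff_dim (upper_H K e s) \<le> ereal (max (t - s) 0))))"
proof (intro conjI impI allI)
  fix s :: real assume s: "max (t - 1) 0 < s \<and> s \<le> 1"
  show "almost_every_direction (\<lambda>e. hausdorff_dim (lower_H K e s) \<le> ereal (max (t - s) 0))"
    unfolding lower_H_def
  proof (rule almost_every_directionI[where R = "\<lambda>X. ereal s \<le> lower_box_dim X"])
    fix i i' :: 2 assume ii: "i \<noteq> i'"
    show "AE m in lborel. \<bar>m\<bar> \<le> 1 \<longrightarrow> hausdorff_dim {z\<in>K. ereal s \<le> lower_box_dim
        {w\<in>K. w $ i - m * w $ i' = z $ i - m * z $ i'}} \<le> ereal (max (t - s) 0)"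
      by (rule AE_hausdorff_dim_le[OF ii assms(2) conjunct1[OF s] lower_slices_rich[OF ii assms(1-4)]])
  qed
next
  fix s :: real assume reg: "ahlfors_regular t K" and s: "max (t - 1) 0 < s \<and> s \<le> 1"
  show "almost_every_direction (\<lambda>e. hausdorff_dim (upper_H K e s) \<le> ereal (max (t - s) 0))"
    unfolding upper_H_def
  proof (rule almost_every_directionI[where R = "\<lambda>X. ereal s \<le> upper_box_dim X"])
    fix i i' :: 2 assume ii: "i \<noteq> i'"
    show "AE m in lborel. \<bar>m\<bar> \<le> 1 \<longrightarrow> hausdorff_dim {z\<in>K. ereal s \<le> upper_box_dim
        {w\<in>K. w $ i - m * w $ i' = z $ i - m * z $ i'}} \<le> ereal (max (t - s) 0)"
      by (rule AE_hausdorff_dim_le[OF ii assms(2) conjunct1[OF s] upper_slices_rich[OF ii reg assms(4)]])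
  qed
qed

end
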